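(* Fix one of the types A, B, D below, and let $u=1$ for type A and $u=\tfrac12$ for types B and D. For every $\varepsilon\in(0,\tfrac12)$ there exist $\delta=\delta(\varepsilon)\in(0,1)$ and $C=C(\varepsilon)>0$ such that for all $d,n$ with $n>e^{d/(u-\varepsilon)}$ and every tuple $(\xi'_1,\dots,\xi'_n)$ of random vectors in $\mathbb{R}^d$ satisfying all assumptions of that type except possibly the general position assumption, the associated convex hull $H'_{n,d}$ satisfies $$\mathbb{P}[0\in H'_{n,d}]\ge1-Cn^{-\delta}.$$
   Context: For a tuple $(\xi'_1,\dots,\xi'_n)$ of random vectors in $\mathbb{R}^d$, put $S'_k=\xi'_1+\dots+\xi'_k$ and $(S_n^* )'=S'_{n-1}-\xi'_n$. Type A: $n\ge d+1$; the tuple is exchangeable ($(\xi'_1,\dots,\xi'_n)\stackrel{d}{=}(\xi'_{\sigma(1)},\dots,\xi'_{\sigma(n)})$ for all permutations $\sigma$); $S'_n=0$ a.s.; general position assumption: any $d$ vectors among $S'_1,\dots,S'_{n-1}$ are linearly independent a.s.; $H'_{n,d}=\mathrm{Conv}(S'_1,\dots,S'_{n-1})$. Type B: $n\ge d$; $(\xi'_1,\dots,\xi'_n)\stackrel{d}{=}(\varepsilon_1\xi'_{\sigma(1)},\dots,\varepsilon_n\xi'_{\sigma(n)})$ for all permutations $\sigma$ and all signs $\varepsilon_i\in\{-1,1\}$; general position assumption: any $d$ vectors among $S'_1,\dots,S'_n$ are linearly independent a.s.; $H'_{n,d}=\mathrm{Conv}(S'_1,\dots,S'_n)$. Type D: $n\ge\max\{2,d\}$;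 the same invariance as type B but only for signs with $\varepsilon_1\cdots\varepsilon_n=1$; general position assumption: any $d$ vectors from either collection $S'_1,\dots,S'_n$ or $S'_1,\dots,S'_{n-1},(S_n^* )'$ are linearly independent a.s.; $H'_{n,d}=\mathrm{Conv}(S'_1,\dots,S'_n,(S_n^* )')$. *)

theory Defs
  imports "HOL-Probability.Probability"
begin

datatype rtype = TypeA | TypeB | TypeD

definition u_of :: "rtype \<Rightarrow> real" where
  "u_of t = (if t = TypeA then 1 else 1/2)"

text \<open>A tuple (xi'_1,...,xi'_n) of random vectors in R^d is encoded through its joint
  law, a probability measure on tuple_space n d.  A point omega of that space is
  a function with omega i j = j-th coordinate of xi'_i (1 <= i <= n, 0 <= j < d).\<close>
definition tuple_space :: "nat \<Rightarrow> nat \<Rightarrow> (nat \<Rightarrow> nat \<Rightarrow> real) measure" where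
  "tuple_space n d = PiM {1..n} (\<lambda>_. PiM {..<d} (\<lambda>_. borel))"

definition xi_vec :: "nat \<Rightarrow> (nat \<Rightarrow> nat \<Rightarrow> real) \<Rightarrow> nat \<Rightarrow> (nat \<Rightarrow> real)" where
  "xi_vec d \<omega> i = (\<lambda>j. if j < d then \<omega> i j else 0)"

definition S_vec :: "nat \<Rightarrow> (nat \<Rightarrow> nat \<Rightarrow> real) \<Rightarrow> nat \<Rightarrow> (nat \<Rightarrow> real)" where
  "S_vec d \<omega> k = (\<lambda>j. \<Sum>i\<in>{1..k}. xi_vec d \<omega> i j)"

definition Sstar_vec :: "nat \<Rightarrow> nat \<Rightarrow> (nat \<Rightarrow> nat \<Rightarrow> real) \<Rightarrow> (nat \<Rightarrow> real)" where
  "Sstar_vec d n \<omega> = (\<lambda>j. S_vec d \<omega> (n - 1) j - xi_vec d \<omega> n j)"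

definition in_conv_hull :: "nat \<Rightarrow> (nat \<Rightarrow> real) set \<Rightarrow> (nat \<Rightarrow> real) \<Rightarrow> bool" where
  "in_conv_hull d P x \<longleftrightarrow>
     (\<exists>w :: (nat \<Rightarrow> real) \<Rightarrow> real. (\<forall>p\<in>P. 0 \<le> w p) \<and> sum w P = 1 \<and>
        (\<forall>j<d. (\<Sum>p\<in>P. w p * p j) = x j))"

definition hull_points :: "rtype \<Rightarrow> nat \<Rightarrow> nat \<Rightarrow> (nat \<Rightarrow> nat \<Rightarrow> real) \<Rightarrow> (nat \<Rightarrow> real) set" where
  "hull_points t d n \<omega> =
     (case t of
        TypeA \<Rightarrow> S_vec d \<omega> ` {1..n-1}
      | TypeB \<Rightarrow> S_vec d \<omega> ` {1..n}
      | TypeD \<Rightarrow> insert (Sstar_vec d n \<omega>) (S_vec d \<omega> ` {1..n}))"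

definition signed_perm ::
  "nat \<Rightarrow> nat \<Rightarrow> (nat \<Rightarrow> nat) \<Rightarrow> (nat \<Rightarrow> real) \<Rightarrow> (nat \<Rightarrow> nat \<Rightarrow> real) \<Rightarrow> (nat \<Rightarrow> nat \<Rightarrow> real)" where
  "signed_perm n d \<sigma> \<epsilon> \<omega> = (\<lambda>i\<in>{1..n}. \<lambda>j\<in>{..<d}. \<epsilon> i * \<omega> (\<sigma> i) j)"

definition type_assms :: "rtype \<Rightarrow> nat \<Rightarrow> nat \<Rightarrow> (nat \<Rightarrow> nat \<Rightarrow> real) measure \<Rightarrow> bool" where
  "type_assms t d n P \<longleftrightarrow>
     (case t of
        TypeA \<Rightarrow> n \<ge> d + 1 \<and>
          (\<forall>\<sigma>. \<sigma> permutes {1..n} \<longrightarrow> distr P (tuple_space n d) (signed_perm n d \<sigma> (\<lambda>_. 1)) = P) \<and>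
          (AE \<omega> in P. S_vec d \<omega> n = (\<lambda>_. 0))
      | TypeB \<Rightarrow> n \<ge> d \<and>
          (\<forall>\<sigma> \<epsilon>. \<sigma> permutes {1..n} \<longrightarrow> (\<forall>i\<in>{1..n}. \<epsilon> i \<in> {-1, 1}) \<longrightarrow>
             distr P (tuple_space n d) (signed_perm n d \<sigma> \<epsilon>) = P)
      | TypeD \<Rightarrow> n \<ge> max 2 d \<and>
          (\<forall>\<sigma> \<epsilon>. \<sigma> permutes {1..n} \<longrightarrow> (\<forall>i\<in>{1..n}. \<epsilon> i \<in> {-1, 1}) \<longrightarrow>
             (\<Prod>i\<in>{1..n}. \<epsilon> i) = 1 \<longrightarrow>
             distr P (tuple_space n d) (signed_perm n d \<sigma> \<epsilon>) = P))"

end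

(*
  A relation x_1 xi_1 + ... + x_n xi_n = 0 with decreasing, non-constant coefficients (in types B and D:
  also nonnegative ones) places 0 in the hull of the partial sums, by Abel summation. So it suffices to
  count the Weyl chambers containing a nontrivial relation. Insert the vector xi into an arrangement of
  m vectors. If an arrangement with xi added to (or, for type B, subtracted from) one of its steps, or
  with xi left out in type B, has such a relation, then so have the two neighbouring insertions of xi;
  and a relation modulo xi makes at least one insertion succeed. Since insertions and modifications
  alternate, there are at least as many successful insertions as successful modifications, plus one
  if there is a relation modulo xi. This gives the deletion-restriction inequality without any
  general position assumption, and by induction a Chernoff-type bound on the fraction of failing
  chambers. Averaging over the symmetry group finishes the proof; type D reduces to type B.
*)
theory Submission
  imports Defs
begin

section \<open>Signed arrangements and the relations in their Weyl chambers\<close>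

definition insert_at :: "nat \<Rightarrow> 'a \<Rightarrow> 'a list \<Rightarrow> 'a list" where
  "insert_at j e ys = take j ys @ e # drop j ys"

text \<open>The flag \<open>b\<close> selects the reflection group: permutations only (type A) if it is
  false, signed permutations (type B) if it is true.\<close>

definition signs :: "bool \<Rightarrow> real list" where
  "signs b = (if b then [1, -1] else [1])"

text \<open>Enumerates the symmetric group, or for true \<open>b\<close> the hyperoctahedral group,
  by inserting the largest index with each sign into each of the \<open>m + 1\<close> gaps. As a
  list, it lets counts unfold into nested sums along this recursion.\<close>

primrec arrangements :: "bool \<Rightarrow> nat \<Rightarrow> (nat \<times> real) list list" where
  "arrangements b 0 = [[]]"
| "arrangements b (Suc m) = concat (map (\<lambda>L. concat (map (\<lambda>s. map (\<lambda>j. insert_at j (Suc m, s) L) [0..<Suc m])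
      (signs b))) (arrangements b m))"

text \<open>The entry \<open>(i, s)\<close> at position \<open>k\<close> means that the \<open>k\<close>-th step of the walk is
  \<open>s * \<xi>\<^sub>i\<close>. The closed Weyl chamber of the list consists of the \<open>x\<close> for which
  \<open>vals b x L\<close> decreases; the extra entry 0 encodes the additional inequality
  \<open>0 \<le> s * x i\<close> of type B and turns non-vanishing into non-constancy, so that
  both types share one definition of absorption.\<close>

definition vals :: "bool \<Rightarrow> (nat \<Rightarrow> real) \<Rightarrow> (nat \<times> real) list \<Rightarrow> real list" where
  "vals b x L = map (\<lambda>(i, s). s * x i) L @ (if b then [0] else [])"

text \<open>The relation is tested only in the coordinates \<open>J\<close>, a set that can shrink
  when a coordinate is eliminated. The coefficients \<open>x\<close> are indexed by vectors rather
  than positions, so the order and signs in \<open>L\<close> enter only through the chamber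
  condition.\<close>

definition absorbing :: "bool \<Rightarrow> (nat \<Rightarrow> nat \<Rightarrow> real) \<Rightarrow> nat set \<Rightarrow> (nat \<times> real) list \<Rightarrow> bool" where
  "absorbing b v J L \<longleftrightarrow> (\<exists>x. sorted_wrt (\<ge>) (vals b x L) \<and>
     (\<exists>p\<in>set (vals b x L). \<exists>q\<in>set (vals b x L). p \<noteq> q) \<and>
     (\<forall>j\<in>J. (\<Sum>i=1..length L. x i * v i j) = 0))"

definition is_arrangement :: "bool \<Rightarrow> nat \<Rightarrow> (nat \<times> real) list \<Rightarrow> bool" where
  "is_arrangement b m L \<longleftrightarrow> length L = m \<and> distinct (map fst L) \<and> fst ` set L = {1..m} \<and>
     snd ` set L \<subseteq> set (signs b)"

lemma length_insert_at [simp]: "length (insert_at j e L) = Suc (length L)"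
  by (simp add: insert_at_def)

lemma set_insert_at [simp]: "set (insert_at j e L) = insert e (set L)"
proof -
  have "set L = set (take j L) \<union> set (drop j L)"
    by (metis append_take_drop_id set_append)
  then show ?thesis by (simp add: insert_at_def)
qed

lemma map_insert_at: "map f (insert_at j e L) = insert_at j (f e) (map f L)"
  by (simp add: insert_at_def take_map drop_map)

lemma distinct_insert_at [simp]: "distinct (insert_at j e L) \<longleftrightarrow> e \<notin> set L \<and> distinct L"
proof -
  have "mset (insert_at j e L) = mset (e # L)"
    unfolding insert_at_def by (metis append_take_drop_id mset.simps(2) mset_append union_mset_add_mset_right)
  then have "distinct (insert_at j e L) \<longleftrightarrow> distinct (e # L)"
    by (rule mset_eq_imp_distinct_iff)
  then show ?thesis by simp
qed

lemma arrangements_is_arrangement: "L \<in> set (arrangements b m) \<Longrightarrow> is_arrangement b m L"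
proof (induction m arbitrary: L)
  case 0
  then show ?case by (simp add: is_arrangement_def)
next
  case (Suc m)
  then obtain K s j where K: "K \<in> set (arrangements b m)" "s \<in> set (signs b)" "L = insert_at j (Suc m, s) K"
    by auto
  from Suc.IH[OF K(1)] have "is_arrangement b m K" .
  moreover from this have "Suc m \<notin> fst ` set K"
    by (simp add: is_arrangement_def)
  ultimately show ?case using K(2,3)
    by (auto simp: is_arrangement_def map_insert_at)
qed

lemma sum_list_map_concat_map:
  fixes f :: "_ \<Rightarrow> real"
  shows "sum_list (map f (concat (map g xs))) = (\<Sum>x\<leftarrow>xs. sum_list (map f (g x)))"
  by (induction xs) auto

lemma sum_arrangements_Suc:
  fixes f :: "_ \<Rightarrow> real"
  shows "(\<Sum>L\<leftarrow>arrangements b (Suc m). f L) =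
    (\<Sum>L\<leftarrow>arrangements b m. \<Sum>s\<leftarrow>signs b. \<Sum>j\<le>m. f (insert_at j (Suc m, s) L))"
proof -
  have "sum_list (map f (map (\<lambda>j. insert_at j (Suc m, s) L) [0..<Suc m])) = (\<Sum>j\<le>m. f (insert_at j (Suc m, s) L))" for s L
    by (simp only: map_map o_def sum_list_distinct_conv_sum_set distinct_upt set_upt lessThan_Suc_atMost[symmetric] atLeast0LessThan)
  then show ?thesis
    by (simp only: arrangements.simps sum_list_map_concat_map)
qed

section \<open>Insertions, modifications and the deletion-restriction count\<close>

text \<open>Insertions and modifications alternate along a line: merging the new step with the \<open>k\<close>-th
  one is the wall between inserting it just before and just after.\<close>

lemma chain_count:
  fixes I H :: "nat \<Rightarrow> bool"
  assumes "\<And>k. k < m \<Longrightarrow> H k \<Longrightarrow> I k \<and> I (Suc k)"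
  shows "(\<Sum>k<m. of_bool (H k)) + of_bool (\<exists>k\<le>m. I k) \<le> (\<Sum>k\<le>m. of_bool (I k) :: real)"
  using assms
proof (induction m)
  case 0
  then show ?case by simp
next
  case (Suc m)
  have IH: "(\<Sum>k<m. of_bool (H k)) + of_bool (\<exists>k\<le>m. I k) \<le> (\<Sum>k\<le>m. of_bool (I k) :: real)"
    using Suc by auto
  have "H m \<Longrightarrow> I m \<and> I (Suc m)"
    using Suc.prems by blast
  \<comment> \<open>If \<open>H m\<close> holds, both indicators on the right are 1. If not, a
    successful index up to \<open>Suc m\<close> is seen by one of them.\<close>
  then have "of_bool (H m) + of_bool (\<exists>k\<le>Suc m. I k)
      \<le> of_bool (\<exists>k\<le>m. I k) + (of_bool (I (Suc m)) :: real)"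
    by (auto simp: le_Suc_eq)
  with IH show ?case by simp
qed

text \<open>On a wall the new value ties with the \<open>k\<close>-th one, so the value list cannot
  tell the two adjacent positions apart; one witness serves both.\<close>

lemma insert_at_nth:
  assumes "k < length ys"
  shows "insert_at (Suc k) (ys ! k) ys = insert_at k (ys ! k) ys"
  using assms by (simp add: insert_at_def take_Suc_conv_app_nth Cons_nth_drop_Suc)

lemma sorted_insert_at_nth:
  assumes "k < length ys" "sorted_wrt (\<ge>) (ys @ zs)"
  shows "sorted_wrt (\<ge>) (insert_at k (ys ! k) ys @ (zs :: real list))"
proof -
  have "sorted_wrt (\<ge>) (take k ys @ ys ! k # drop (Suc k) ys @ zs)"
    using assms by (metis append.assoc append_Cons id_take_nth_drop)
  moreover have "insert_at k (ys ! k) ys @ zs = take k ys @ ys ! k # ys ! k # drop (Suc k) ys @ zs"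
    using assms by (simp add: insert_at_def Cons_nth_drop_Suc)
  ultimately show ?thesis
    by (auto simp: sorted_wrt_append)
qed

lemma exists_sorted_insert:
  assumes "sorted_wrt (\<ge>) (ys :: real list)"
  shows "\<exists>p\<le>length ys. sorted_wrt (\<ge>) (insert_at p c ys)"
  using assms
proof (induction ys)
  case Nil
  then show ?case by (simp add: insert_at_def)
next
  case (Cons y ys)
  then obtain p where p: "p \<le> length ys" "sorted_wrt (\<ge>) (insert_at p c ys)"
    by auto
  show ?case
  proof (cases "c \<ge> y")
    case True
    then show ?thesis using Cons.prems
      by (intro exI[of _ 0]) (force simp: insert_at_def)
  next
    case False
    then show ?thesis using p Cons.prems
      by (intro exI[of _ "Suc p"]) (auto simp: insert_at_def[of "Suc p"] insert_at_def[symmetric])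
  qed
qed

text \<open>Used to read a relation among modified vectors as one among the original vectors and
  \<open>w\<close>, with \<open>w\<close> carrying the coefficient \<open>c * x i\<close>.\<close>

lemma sum_update_add:
  fixes x :: "nat \<Rightarrow> real"
  assumes "i \<in> {1..m}"
  shows "(\<Sum>k=1..m. x k * (v(i := \<lambda>j. v i j + c * w j)) k j)
       = (\<Sum>k=1..m. x k * v k j) + c * x i * w j"
proof -
  have "(\<Sum>k=1..m. x k * (v(i := \<lambda>j. v i j + c * w j)) k j)
      = (\<Sum>k=1..m. x k * v k j + (if k = i then c * x i * w j else 0))"
    by (rule sum.cong) (auto simp: algebra_simps)
  then show ?thesis using assms by (simp add: sum.distrib)
qed

lemma vals_insert_at:
  assumes "is_arrangement b m L"
  shows "vals b (x(Suc m := c)) (insert_at k (Suc m, s) L) =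
     insert_at k (s * c) (map (\<lambda>(i, s). s * x i) L) @ (if b then [0] else [])"
proof -
  have "Suc m \<notin> fst ` set L" using assms by (simp add: is_arrangement_def)
  then have "map (\<lambda>(i, s). s * (x(Suc m := c)) i) L = map (\<lambda>(i, s). s * x i) L" by force
  then show ?thesis by (simp only: vals_def map_insert_at) simp
qed

lemma set_vals_insert_at:
  assumes "is_arrangement b m L"
  shows "set (vals b (x(Suc m := c)) (insert_at k (Suc m, s) L)) = insert (s * c) (set (vals b x L))"
  by (simp add: vals_insert_at[OF assms]) (simp add: vals_def)

text \<open>The witness is \<open>x(Suc m := c)\<close>. Relations use coefficients while chambers
  compare signed values, hence \<open>c\<close> in the sum but \<open>s * c\<close> in the
  list.\<close>

lemma absorbingI_insert_at:
  assumes L: "is_arrangement b m L"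
    and "sorted_wrt (\<ge>) (insert_at k (s * c) (map (\<lambda>(i, s). s * x i) L) @ (if b then [0] else []))"
    and "\<exists>p\<in>insert (s * c) (set (vals b x L)). \<exists>q\<in>insert (s * c) (set (vals b x L)). p \<noteq> q"
    and "\<And>j. j \<in> J \<Longrightarrow> (\<Sum>i=1..m. x i * v i j) + c * v (Suc m) j = 0"
  shows "absorbing b v J (insert_at k (Suc m, s) L)"
proof -
  let ?x = "x(Suc m := c)"
  have "length L = m" using L by (simp add: is_arrangement_def)
  then have "\<forall>j\<in>J. (\<Sum>i=1..length (insert_at k (Suc m, s) L). (x(Suc m := c)) i * v i j) = 0"
    using assms(4) by simp
  moreover have "sorted_wrt (\<ge>) (vals b ?x (insert_at k (Suc m, s) L))"
    unfolding vals_insert_at[OF L] by (rule assms(2))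
  moreover have "\<exists>p\<in>set (vals b ?x (insert_at k (Suc m, s) L)).
      \<exists>q\<in>set (vals b ?x (insert_at k (Suc m, s) L)). p \<noteq> q"
    unfolding set_vals_insert_at[OF L] by (rule assms(3))
  ultimately show ?thesis
    unfolding absorbing_def by blast
qed

text \<open>The new vector receives the coefficient \<open>s * e * x i\<close>. As
  \<open>s * s = 1\<close>, its signed value is \<open>e * x i\<close>, the value of entry
  \<open>k\<close>, so the enlarged list stays sorted with the new entry on either side.\<close>

lemma absorbing_modified_imp_absorbing_insert:
  assumes L: "is_arrangement b m L" and k: "k < m" and i: "L ! k = (i, e)" and s: "s \<in> {1, -1}"
    and absorbing: "absorbing b (v(i := \<lambda>j. v i j + s * e * v (Suc m) j)) J L"
  shows "absorbing b v J (insert_at k (Suc m, s) L) \<and> absorbing b v J (insert_at (Suc k) (Suc m, s) L)"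
proof -
  have len: "length L = m" using L by (simp add: is_arrangement_def)
  have "L ! k \<in> set L" using k len by auto
  then have im: "i \<in> {1..m}" using L i by (force simp: is_arrangement_def)
  obtain x where x: "sorted_wrt (\<ge>) (vals b x L)"
    "\<exists>p\<in>set (vals b x L). \<exists>q\<in>set (vals b x L). p \<noteq> q"
    "\<And>j. j \<in> J \<Longrightarrow> (\<Sum>k=1..m. x k * (v(i := \<lambda>j. v i j + s * e * v (Suc m) j)) k j) = 0"
    using absorbing len unfolding absorbing_def by blast
  let ?c = "s * e * x i"
  let ?ys = "map (\<lambda>(i, s). s * x i) L"
  have sc: "s * ?c = ?ys ! k" using s k len i by auto
  have srt: "sorted_wrt (\<ge>) (insert_at k (s * ?c) ?ys @ (if b then [0] else []))"
    unfolding sc using k len x(1) by (intro sorted_insert_at_nth) (auto simp: vals_def)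
  have srt': "sorted_wrt (\<ge>) (insert_at (Suc k) (s * ?c) ?ys @ (if b then [0] else []))"
    using srt k len insert_at_nth[of k ?ys] unfolding sc by simp
  have eq: "(\<Sum>i=1..m. x i * v i j) + ?c * v (Suc m) j = 0" if "j \<in> J" for j
    using x(3)[OF that] sum_update_add[OF im, of x v "s * e" "v (Suc m)" j] by simp
  have ne: "\<exists>p\<in>insert (s * ?c) (set (vals b x L)).
      \<exists>q\<in>insert (s * ?c) (set (vals b x L)). p \<noteq> q"
    using x(2) by auto
  show ?thesis
    using absorbingI_insert_at[OF L srt ne eq] absorbingI_insert_at[OF L srt' ne eq] by (rule conjI)
qed

text \<open>The wall special to type B, where the new coefficient is 0: the new entry then fits
  directly before the final 0, whatever its sign.\<close>

lemma absorbing_imp_absorbing_insert_last: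
  assumes L: "is_arrangement True m L" and absorbing: "absorbing True v J L"
  shows "absorbing True v J (insert_at m (Suc m, s) L)"
proof -
  have len: "length L = m" using L by (simp add: is_arrangement_def)
  obtain x where x: "sorted_wrt (\<ge>) (vals True x L)"
    "\<exists>p\<in>set (vals True x L). \<exists>q\<in>set (vals True x L). p \<noteq> q"
    "\<And>j. j \<in> J \<Longrightarrow> (\<Sum>k=1..m. x k * v k j) = 0"
    using absorbing len unfolding absorbing_def by blast
  have "sorted_wrt (\<ge>) (insert_at m (s * 0) (map (\<lambda>(i, s). s * x i) L) @ (if True then [0] else []))"
    using x(1) len by (auto simp: vals_def insert_at_def sorted_wrt_append)
  moreover have "\<exists>p\<in>insert (s * 0) (set (vals True x L)).
      \<exists>q\<in>insert (s * 0) (set (vals True x L)). p \<noteq> q"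
    using x(2) by (meson insertI2)
  ultimately show ?thesis
    by (rule absorbingI_insert_at[OF L]) (simp add: x(3)[simplified])
qed

text \<open>A relation modulo the new vector comes with its coefficient \<open>c\<close>. In type B
  the sign is chosen to make the signed value nonnegative, which is why non-constancy is also
  assumed for \<open>-c\<close>; sorting then gives the position.\<close>

lemma exists_absorbing_insert_of_sorted:
  assumes L: "is_arrangement b m L" and x: "sorted_wrt (\<ge>) (vals b x L)"
    "\<exists>p\<in>insert c (set (vals b x L)). \<exists>q\<in>insert c (set (vals b x L)). p \<noteq> q"
    "b \<Longrightarrow> \<exists>p\<in>insert (-c) (set (vals b x L)). \<exists>q\<in>insert (-c) (set (vals b x L)). p \<noteq> q"
    "\<And>j. j \<in> J \<Longrightarrow> (\<Sum>k=1..m. x k * v k j) + c * v (Suc m) j = 0"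
  shows "\<exists>s\<in>set (signs b). \<exists>k\<le>m. absorbing b v J (insert_at k (Suc m, s) L)"
proof -
  have len: "length L = m" using L by (simp add: is_arrangement_def)
  let ?ys = "map (\<lambda>(i, s). s * x i) L"
  define s where "s = (if b \<and> c < 0 then -1 else 1 :: real)"
  have s: "s \<in> set (signs b)" by (auto simp: s_def signs_def)
  have "sorted_wrt (\<ge>) ?ys" using x(1) by (auto simp: vals_def sorted_wrt_append)
  from exists_sorted_insert[OF this, of "s * c"] obtain p
    where p: "p \<le> m" "sorted_wrt (\<ge>) (insert_at p (s * c) ?ys)" using len by auto
  have "sorted_wrt (\<ge>) (insert_at p (s * c) ?ys @ (if b then [0] else []))"
  proof (cases b)
    case True
    have "s * c \<ge> 0" using True by (auto simp: s_def)
    moreover have "\<forall>y\<in>set ?ys. y \<ge> 0" using x(1) True by (auto simp: vals_def sorted_wrt_append)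
    ultimately show ?thesis using p(2) by (auto simp: sorted_wrt_append)
  qed (use p in simp)
  moreover have "\<exists>p\<in>insert (s * c) (set (vals b x L)). \<exists>q\<in>insert (s * c) (set (vals b x L)). p \<noteq> q"
    using x(2,3) by (auto simp: s_def)
  ultimately have "absorbing b v J (insert_at p (Suc m, s) L)"
    using x(4) by (intro absorbingI_insert_at[OF L]) auto
  then show ?thesis using s p by blast
qed

text \<open>A vector vanishing on \<open>J\<close> is a relation by itself, with coefficient 1 for
  it and 0 for the others. Since \<open>m \<ge> 1\<close>, the value 0 occurs besides the 1.\<close>

lemma exists_absorbing_insert_zero:
  assumes L: "is_arrangement b m L" and m: "m \<ge> 1" and v: "\<And>j. j \<in> J \<Longrightarrow> v (Suc m) j = 0"
  shows "\<exists>s\<in>set (signs b). \<exists>k\<le>m. absorbing b v J (insert_at k (Suc m, s) L)"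
proof -
  have len: "length L = m" using L by (simp add: is_arrangement_def)
  then have "L \<noteq> []" using m by auto
  then have *: "set (vals b (\<lambda>_. 0) L) = {0}"
    by (cases L) (auto simp: vals_def)
  have **: "sorted_wrt (\<ge>) (map (\<lambda>(i, s). 0 :: real) L)"
    by (auto simp: sorted_wrt_iff_nth_less split: prod.splits)
  show ?thesis
    by (rule exists_absorbing_insert_of_sorted[OF L, where x = "\<lambda>_. 0" and c = 1])
       (use v * ** in \<open>auto simp: vals_def sorted_wrt_append\<close>)
qed

text \<open>Dividing by the new vector is done by eliminating a coordinate \<open>j0\<close> in which it does not vanish.\<close>

lemma exists_absorbing_insert_quotient:
  assumes L: "is_arrangement b m L" and j0: "v (Suc m) j0 \<noteq> 0"
    and absorbing: "absorbing b (\<lambda>i j. v i j - v i j0 / v (Suc m) j0 * v (Suc m) j) (J - {j0}) L"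
  shows "\<exists>s\<in>set (signs b). \<exists>k\<le>m. absorbing b v J (insert_at k (Suc m, s) L)"
proof -
  have len: "length L = m" using L by (simp add: is_arrangement_def)
  obtain x where x: "sorted_wrt (\<ge>) (vals b x L)"
    "\<exists>p\<in>set (vals b x L). \<exists>q\<in>set (vals b x L). p \<noteq> q"
    "\<And>j. j \<in> J - {j0} \<Longrightarrow> (\<Sum>k=1..m. x k * (v k j - v k j0 / v (Suc m) j0 * v (Suc m) j)) = 0"
    using absorbing len unfolding absorbing_def by blast
  \<comment> \<open>The eliminated relation speaks only about coordinates other than
    \<open>j0\<close>; this coefficient makes it hold at \<open>j0\<close> too.\<close>
  define c where "c = - (\<Sum>k=1..m. x k * v k j0) / v (Suc m) j0"
  have "(\<Sum>k=1..m. x k * v k j) + c * v (Suc m) j = 0" if "j \<in> J" for j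
  proof (cases "j = j0")
    case True
    then show ?thesis using j0 by (simp add: c_def)
  next
    case False
    have "(\<Sum>k=1..m. x k * (v k j - v k j0 / v (Suc m) j0 * v (Suc m) j))
        = (\<Sum>k=1..m. x k * v k j) + c * v (Suc m) j"
      by (simp add: c_def right_diff_distrib sum_subtractf sum_distrib_right sum_divide_distrib mult.assoc)
    with x(3)[of j] that False show ?thesis by simp
  qed
  then show ?thesis
    using x by (intro exists_absorbing_insert_of_sorted[OF L, of x c]) auto
qed

text \<open>For each sign the \<open>m + 1\<close> insertions form a chain whose links are the
  \<open>m\<close> modifications, and \<open>chain_count\<close> leaves a surplus of one per chain
  with a success. These surpluses pay for \<open>X\<close> and, in type B, for the deletion
  term.\<close>

lemma count_absorbing_insert:
  assumes L: "is_arrangement b m L"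
    and X: "X \<Longrightarrow> \<exists>s\<in>set (signs b). \<exists>k\<le>m. absorbing b v J (insert_at k (Suc m, s) L)"
  shows "(\<Sum>s\<leftarrow>signs b. \<Sum>i=1..m. of_bool (absorbing b (v(i := \<lambda>j. v i j + s * v (Suc m) j)) J L))
       + (if b then of_bool (absorbing b v J L) else 0) + of_bool X
     \<le> (\<Sum>s\<leftarrow>signs b. \<Sum>k\<le>m. of_bool (absorbing b v J (insert_at k (Suc m, s) L)) :: real)"
proof -
  have len: "length L = m" and dis: "distinct (map fst L)" and fs: "fst ` set L = {1..m}"
    and sn: "snd ` set L \<subseteq> set (signs b)"
    using L by (auto simp: is_arrangement_def)
  define F where "F s i = (of_bool (absorbing b (v(i := \<lambda>j. v i j + s * v (Suc m) j)) J L) :: real)" for s i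
  define I where "I s k = absorbing b v J (insert_at k (Suc m, s) L)" for s k
  have bij: "bij_betw (\<lambda>k. fst (L ! k)) {..<m} {1..m}"
  proof -
    have "bij_betw (\<lambda>k. map fst L ! k) {..<m} {1..m}"
      using bij_betw_nth[OF dis, of "{..<m}" "{1..m}"] len fs by simp
    moreover have "bij_betw (\<lambda>k. map fst L ! k) {..<m} {1..m} \<longleftrightarrow> bij_betw (\<lambda>k. fst (L ! k)) {..<m} {1..m}"
      using len by (intro bij_betw_cong) simp
    ultimately show ?thesis by (rule iffD1[rotated])
  qed
  have reidx: "(\<Sum>i=1..m. F s i) = (\<Sum>k<m. F s (fst (L ! k)))" for s
    using sum.reindex_bij_betw[OF bij, of "F s"] by simp
  have sgn: "snd (L ! k) \<in> set (signs b)" if "k < m" for k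
    using sn that len by (meson image_subset_iff nth_mem)
  \<comment> \<open>The link at entry \<open>k\<close> carries \<open>s\<close> times the sign of
    that entry. Multiplication by this sign permutes \<open>signs b\<close>, so the sum over
    \<open>s\<close> absorbs it.\<close>
  have swap: "(\<Sum>s\<leftarrow>signs b. F s (fst (L ! k))) = (\<Sum>s\<leftarrow>signs b. F (s * snd (L ! k)) (fst (L ! k)))"
    if "k < m" for k
    using sgn[OF that] by (cases b) (auto simp: signs_def)
  have "(\<Sum>s\<leftarrow>signs b. \<Sum>i=1..m. F s i) = (\<Sum>k<m. \<Sum>s\<leftarrow>signs b. F s (fst (L ! k)))"
    unfolding reidx by (cases b) (auto simp: signs_def sum.distrib)
  also have "\<dots> = (\<Sum>k<m. \<Sum>s\<leftarrow>signs b. F (s * snd (L ! k)) (fst (L ! k)))"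
    using swap by simp
  also have "\<dots> = (\<Sum>s\<leftarrow>signs b. \<Sum>k<m. F (s * snd (L ! k)) (fst (L ! k)))"
    by (cases b) (auto simp: signs_def sum.distrib)
  finally have eq: "(\<Sum>s\<leftarrow>signs b. \<Sum>i=1..m. F s i) =
      (\<Sum>s\<leftarrow>signs b. \<Sum>k<m. F (s * snd (L ! k)) (fst (L ! k)))" .
  have chain: "(\<Sum>k<m. F (s * snd (L ! k)) (fst (L ! k))) + of_bool (\<exists>k\<le>m. I s k)
      \<le> (\<Sum>k\<le>m. of_bool (I s k))" if "s \<in> {1, -1}" for s
    unfolding F_def I_def
    by (rule chain_count) (rule absorbing_modified_imp_absorbing_insert[OF L _ prod.collapse[symmetric] that], auto)
  have extra: "(if b then of_bool (absorbing b v J L) else 0) + of_bool X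
      \<le> (\<Sum>s\<leftarrow>signs b. of_bool (\<exists>k\<le>m. I s k) :: real)"
  proof (cases b)
    case True
    \<comment> \<open>If \<open>L\<close> itself is absorbing, both chains contain a success and
      their surplus of two covers the deletion term and \<open>X\<close>. Otherwise \<open>X\<close>
      needs just one such chain.\<close>
    have 1: "\<exists>k\<le>m. I s k" if "absorbing b v J L" for s
      using absorbing_imp_absorbing_insert_last[of m L v J s] that True L by (auto simp: I_def)
    have 2: "X \<Longrightarrow> (\<exists>k\<le>m. I 1 k) \<or> (\<exists>k\<le>m. I (-1) k)"
      using X True by (auto simp: signs_def I_def)
    show ?thesis using 1[of 1] 1[of "-1"] 2 True by (cases "absorbing b v J L") (auto simp: signs_def)
  next
    case False
    then show ?thesis using X by (auto simp: signs_def I_def)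
  qed
  have "(\<Sum>s\<leftarrow>signs b. \<Sum>k<m. F (s * snd (L ! k)) (fst (L ! k))) + (\<Sum>s\<leftarrow>signs b. of_bool (\<exists>k\<le>m. I s k))
     \<le> (\<Sum>s\<leftarrow>signs b. \<Sum>k\<le>m. of_bool (I s k))"
    using chain[of 1] chain[of "-1"] by (cases b) (simp_all add: signs_def)
  with eq extra show ?thesis unfolding F_def I_def by linarith
qed

section \<open>Induction for the number of absorbing arrangements\<close>

text \<open>The reciprocal of the number of signs, so that the \<open>k\<close>-th vector has
  \<open>k / sign_rate b\<close> insertions; this is the \<open>u\<close> of the theorem.\<close>

definition sign_rate :: "bool \<Rightarrow> real" where
  "sign_rate b = (if b then 1 / 2 else 1)"

text \<open>Without equations any non-constant point of the chamber will do: value 1 at the first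
  entry, obtained as \<open>s * s\<close>, and 0 afterwards.\<close>

lemma absorbing_empty_coords:
  assumes L: "is_arrangement b m L" and m: "m \<ge> 2"
  shows "absorbing b v {} L"
proof -
  obtain e1 e2 K where K: "L = e1 # e2 # K"
    using L m by (auto simp: is_arrangement_def numeral_2_eq_2 Suc_le_length_iff)
  obtain i s where e1: "e1 = (i, s)" by force
  define x where "x = (\<lambda>k. if k = i then s else 0 :: real)"
  have dis: "distinct (map fst L)" using L by (simp add: is_arrangement_def)
  have "s \<in> set (signs b)" using L by (auto simp: is_arrangement_def K e1)
  then have s: "s * s = 1" by (auto simp: signs_def split: if_splits)
  have z: "map (\<lambda>(i, s). s * x i) (e2 # K) = map (\<lambda>_. 0) (e2 # K)"
  proof (rule map_cong[OF refl])
    fix e assume "e \<in> set (e2 # K)"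
    then have "fst e \<in> fst ` set (e2 # K)" by (rule imageI)
    moreover have "i \<notin> fst ` set (e2 # K)" using dis by (simp add: K e1)
    ultimately show "(case e of (i, s) \<Rightarrow> s * x i) = 0"
      by (cases e) (auto simp: x_def)
  qed
  have "vals b x L = 1 # map (\<lambda>_. 0) (e2 # K) @ (if b then [0] else [])"
    unfolding vals_def K by (simp only: list.map(2) z[simplified list.map(2)]) (simp add: e1 x_def s)
  moreover have "sorted_wrt (\<ge>) (map (\<lambda>_. 0 :: real) xs)" for xs :: "(nat \<times> real) list"
    by (simp add: sorted_wrt_iff_nth_less)
  ultimately show ?thesis
    unfolding absorbing_def by (intro exI[of _ x]) (auto simp: sorted_wrt_append)
qed

lemma length_arrangements_Suc:
  "real (length (arrangements b (Suc m))) = real (length (arrangements b m)) * ((real m + 1) / sign_rate b)"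
proof -
  have "real (length (arrangements b (Suc m))) = (\<Sum>L\<leftarrow>arrangements b (Suc m). 1)"
    by (simp only: sum_list_triv mult_1_right)
  also have "\<dots> = (\<Sum>L\<leftarrow>arrangements b m. (real m + 1) / sign_rate b)"
    unfolding sum_arrangements_Suc by (cases b) (simp_all add: signs_def sign_rate_def ac_simps)
  finally show ?thesis by (simp add: sum_list_triv)
qed

text \<open>The recursion behind the right-hand side is that of the generating polynomial
  \<open>\<Prod>k. 1 - (1 - z) * u / k\<close> of a sum of independent Bernoulli variables with parameters
  \<open>u / k\<close>; the factor \<open>(1/z) ^ card J\<close> is the Chernoff bound for its lower tail.\<close>

lemma count_absorbing_arrangements:
  fixes v :: "nat \<Rightarrow> nat \<Rightarrow> real"
  assumes "0 < z" "z < 1" "finite J"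
  shows "(\<Sum>L\<leftarrow>arrangements b n. of_bool (absorbing b v J L)) \<ge>
    real (length (arrangements b n)) * (1 - (1/z) ^ card J * (\<Prod>k=2..n. 1 - (1 - z) * sign_rate b / real k))"
  using assms(3)
proof (induction n arbitrary: v J)
  case 0
  have "(1/z) ^ card J \<ge> 1" using assms by (intro one_le_power) simp
  then show ?case by simp
next
  case (Suc m)
  define u where "u = sign_rate b"
  have u: "0 < u" "u \<le> 1" by (auto simp: u_def sign_rate_def)
  define \<pi> where "\<pi> = (\<lambda>n. \<Prod>k=2..n. 1 - (1 - z) * u / real k)"
  have fac: "(1 - z) * u / real k \<le> 1" if "k \<ge> 1" for k
  proof -
    have "(1 - z) * u \<le> 1 * 1" using u assms by (intro mult_mono) auto
    then show ?thesis using that by (simp add: divide_le_eq)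
  qed
  have \<pi>0: "\<pi> n \<ge> 0" for n
    unfolding \<pi>_def by (intro prod_nonneg) (use fac in auto)
  have z1: "(1/z) ^ card J \<ge> 1" for J :: "nat set" using assms by (intro one_le_power) simp
  show ?case
  proof (cases "m = 0")
    \<comment> \<open>For a single vector the product is empty and \<open>1/z\<close> is at least 1,
      so the claimed lower bound is at most 0.\<close>
    case True
    then have "(\<Prod>k=2..Suc m. 1 - (1 - z) * sign_rate b / real k) = 1" by simp
    with z1[of J] have "real (length (arrangements b (Suc m))) * (1 - (1/z) ^ card J * (\<Prod>k=2..Suc m. 1 - (1 - z) * sign_rate b / real k)) \<le> 0"
      by (intro mult_nonneg_nonpos) auto
    also have "0 \<le> (\<Sum>L\<leftarrow>arrangements b (Suc m). of_bool (absorbing b v J L) :: real)"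
      by (intro sum_list_nonneg) auto
    finally show ?thesis .
  next
    case m: False
    have \<pi>S: "\<pi> (Suc m) = \<pi> m * (1 - (1 - z) * u / (real m + 1))"
      unfolding \<pi>_def using m by (subst prod.nat_ivl_Suc') (auto simp: add.commute)
    define N where "N = real (length (arrangements b m))"
    have NS: "real (length (arrangements b (Suc m))) = N * ((real m + 1) / u)"
      unfolding length_arrangements_Suc N_def u_def ..
    have N0: "N \<ge> 0" by (simp add: N_def)
    show ?thesis
    proof (cases "J = {}")
      case True
      have "(\<Sum>L\<leftarrow>arrangements b (Suc m). of_bool (absorbing b v J L)) = (\<Sum>L\<leftarrow>arrangements b (Suc m). 1 :: real)"
      proof (rule arg_cong[of _ _ sum_list], rule map_cong[OF refl])
        fix L assume "L \<in> set (arrangements b (Suc m))"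
        then have "absorbing b v {} L"
          using m by (intro absorbing_empty_coords[OF arrangements_is_arrangement[of _ _ "Suc m"]]) simp_all
        then show "of_bool (absorbing b v J L) = (1 :: real)" using True by simp
      qed
      also have "\<dots> = real (length (arrangements b (Suc m)))"
        by (simp only: sum_list_triv mult_1_right)
      finally have "(\<Sum>L\<leftarrow>arrangements b (Suc m). of_bool (absorbing b v J L)) = real (length (arrangements b (Suc m)))" .
      moreover have "1 - (1/z) ^ card J * \<pi> (Suc m) \<le> 1"
        using \<pi>0[of "Suc m"] assms by simp
      ultimately show ?thesis unfolding \<pi>_def u_def
        by (simp only:) (rule mult_left_le, simp_all only: of_nat_0_le_iff)
    next
      case False
      then have cJ: "card J \<ge> 1" using Suc.prems by (simp add: Suc_leI card_gt_0_iff)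
      \<comment> \<open>\<open>q\<close> bounds the failing fraction for \<open>m\<close> vectors
        and one coordinate fewer, \<open>q / z\<close> the one for all of \<open>J\<close>.\<close>
      define q where "q = (1/z) ^ (card J - 1) * \<pi> m"
      have q0: "q \<ge> 0" using \<pi>0[of m] assms by (simp add: q_def)
      have qz: "(1/z) ^ card J * \<pi> m = q / z"
        using cJ by (simp add: q_def power_eq_if)
      have IH: "(\<Sum>L\<leftarrow>arrangements b m. of_bool (absorbing b w J L)) \<ge> N * (1 - q / z)" for w
        using Suc.IH[OF Suc.prems, of w] unfolding N_def qz[symmetric] \<pi>_def u_def .
      \<comment> \<open>\<open>X\<close> marks a relation modulo the new vector: absorption after
        eliminating a coordinate, or every arrangement if the new vector vanishes on
        \<open>J\<close>. Either way it fails on a fraction of at most \<open>q\<close>.\<close>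
      have "\<exists>X. (\<forall>L. is_arrangement b m L \<longrightarrow> X L \<longrightarrow> (\<exists>s\<in>set (signs b). \<exists>k\<le>m. absorbing b v J (insert_at k (Suc m, s) L))) \<and>
          N * (1 - q) \<le> (\<Sum>L\<leftarrow>arrangements b m. of_bool (X L))"
      proof (cases "\<exists>j0\<in>J. v (Suc m) j0 \<noteq> 0")
        case True
        then obtain j0 where j0: "j0 \<in> J" "v (Suc m) j0 \<noteq> 0" by blast
        let ?w = "\<lambda>i j. v i j - v i j0 / v (Suc m) j0 * v (Suc m) j"
        have "card (J - {j0}) = card J - 1" using j0 Suc.prems by simp
        then have "N * (1 - q) \<le> (\<Sum>L\<leftarrow>arrangements b m. of_bool (absorbing b ?w (J - {j0}) L))"
          using Suc.IH[of "J - {j0}" ?w] Suc.prems unfolding q_def N_def \<pi>_def u_def by simp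
        then show ?thesis
          using exists_absorbing_insert_quotient j0 by (intro exI[of _ "absorbing b ?w (J - {j0})"]) blast
      next
        case False
        have "(\<Sum>L\<leftarrow>arrangements b m. of_bool True) = N"
          by (simp add: sum_list_triv N_def)
        moreover have "N * (1 - q) \<le> N" using q0 N0 by (intro mult_left_le) auto
        ultimately show ?thesis
          using exists_absorbing_insert_zero[of b m _ J v] m False by (intro exI[of _ "\<lambda>_. True"]) auto
      qed
      then obtain X where X: "\<And>L. is_arrangement b m L \<Longrightarrow> X L \<Longrightarrow> \<exists>s\<in>set (signs b). \<exists>k\<le>m. absorbing b v J (insert_at k (Suc m, s) L)"
        and X_sum: "N * (1 - q) \<le> (\<Sum>L\<leftarrow>arrangements b m. of_bool (X L))" by blast
      define V where "V = (\<lambda>s i. v(i := \<lambda>j. v i j + s * v (Suc m) j))"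
      have ins_le: "(\<Sum>L\<leftarrow>arrangements b m. (\<Sum>s\<leftarrow>signs b. \<Sum>i=1..m. of_bool (absorbing b (V s i) J L))
             + (if b then of_bool (absorbing b v J L) else 0) + of_bool (X L))
          \<le> (\<Sum>L\<leftarrow>arrangements b (Suc m). of_bool (absorbing b v J L) :: real)"
        unfolding sum_arrangements_Suc V_def
        by (intro sum_list_mono count_absorbing_insert X arrangements_is_arrangement)
      have swap: "(\<Sum>L\<leftarrow>arrangements b m. (\<Sum>s\<leftarrow>signs b. \<Sum>i=1..m. of_bool (absorbing b (V s i) J L))
             + (if b then of_bool (absorbing b v J L) else 0) + of_bool (X L))
        = (\<Sum>s\<leftarrow>signs b. \<Sum>i=1..m. \<Sum>L\<leftarrow>arrangements b m. of_bool (absorbing b (V s i) J L))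
             + (if b then (\<Sum>L\<leftarrow>arrangements b m. of_bool (absorbing b v J L)) else 0) + (\<Sum>L\<leftarrow>arrangements b m. of_bool (X L) :: real)"
      proof -
        have sw: "(\<Sum>L\<leftarrow>xs. \<Sum>i=1..m. f i L) = (\<Sum>i=1..m. \<Sum>L\<leftarrow>xs. f i L)"
          for f :: "nat \<Rightarrow> (nat \<times> real) list \<Rightarrow> real" and xs
          by (induction xs) (auto simp: sum.distrib)
        show ?thesis
          by (cases b) (simp_all add: signs_def sum_list_addf sw[unfolded One_nat_def] del: sum_of_bool_eq)
      qed
      \<comment> \<open>Modifications and deletion together make \<open>(m + 1) / u - 1\<close>
        tuples of \<open>m\<close> vectors, and the induction hypothesis for \<open>J\<close>
        applies to each of them.\<close>
      have 2: "(\<Sum>s\<leftarrow>signs b. \<Sum>i=1..m. N * (1 - q / z)) + (if b then N * (1 - q / z) else 0) + N * (1 - q)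
         \<le> (\<Sum>L\<leftarrow>arrangements b (Suc m). of_bool (absorbing b v J L))"
      proof (rule order_trans[OF _ ins_le[unfolded swap]])
        show "(\<Sum>s\<leftarrow>signs b. \<Sum>i=1..m. N * (1 - q / z)) + (if b then N * (1 - q / z) else 0) + N * (1 - q)
          \<le> (\<Sum>s\<leftarrow>signs b. \<Sum>i=1..m. \<Sum>L\<leftarrow>arrangements b m. of_bool (absorbing b (V s i) J L))
             + (if b then (\<Sum>L\<leftarrow>arrangements b m. of_bool (absorbing b v J L)) else 0) + (\<Sum>L\<leftarrow>arrangements b m. of_bool (X L) :: real)"
          by (intro add_mono sum_list_mono sum_mono IH X_sum) (use IH[of v] in \<open>cases b; simp\<close>)
      qed
      have "(\<Sum>s\<leftarrow>signs b. \<Sum>i=1..m. N * (1 - q / z)) + (if b then N * (1 - q / z) else 0)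
          = ((real m + 1) / u - 1) * (N * (1 - q / z))"
        by (cases b) (simp_all add: signs_def u_def sign_rate_def algebra_simps)
      moreover have "((real m + 1) / u - 1) * (N * (1 - q / z)) + N * (1 - q)
          = N * ((real m + 1) / u) * (1 - q / z * (1 - (1 - z) * u / (real m + 1)))"
      proof -
        \<comment> \<open>With \<open>M\<close> insertions per arrangement the failing fractions
          average to \<open>((M - 1) * (q / z) + q) / M\<close>, which is \<open>q / z\<close> times
          the new factor \<open>1 - (1 - z) / M\<close>.\<close>
        define M where "M = (real m + 1) / u"
        have M: "M > 0" using u by (simp add: M_def)
        have "(1 - z) * u / (real m + 1) = (1 - z) / M" by (simp add: M_def)
        moreover have "(M - 1) * (N * (1 - q / z)) + N * (1 - q) = N * M * (1 - q / z * (1 - (1 - z) / M))"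
          using M assms(1) by (simp add: field_simps)
        ultimately show ?thesis by (simp add: M_def)
      qed
      ultimately have "N * ((real m + 1) / u) * (1 - q / z * (1 - (1 - z) * u / (real m + 1)))
         \<le> (\<Sum>L\<leftarrow>arrangements b (Suc m). of_bool (absorbing b v J L))" using 2 by simp
      also have "q / z * (1 - (1 - z) * u / (real m + 1)) = (1/z) ^ card J * \<pi> (Suc m)"
        unfolding \<pi>S qz[symmetric] by simp
      finally show ?thesis unfolding NS \<pi>_def u_def .
    qed
  qed
qed

section \<open>Polynomial decay of the failing fraction\<close>

text \<open>The inequality \<open>1 - x \<le> exp (- x)\<close> leads to a harmonic sum starting at
  2; the missing first term costs \<open>exp a\<close>, at most \<open>exp 1\<close>.\<close>

lemma prod_one_minus_le:
  assumes "0 \<le> a" "a \<le> 1" "n \<ge> 1"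
  shows "(\<Prod>k=2..n. 1 - a / real k) \<le> exp 1 * real n powr (- a)"
proof -
  have "(\<Prod>k=2..n. 1 - a / real k) \<le> (\<Prod>k=2..n. exp (- a / real k))"
  proof (rule prod_mono)
    fix k assume "k \<in> {2..n}"
    then show "0 \<le> 1 - a / real k \<and> 1 - a / real k \<le> exp (- a / real k)"
      using assms exp_ge_add_one_self[of "- a / real k"] by (auto simp: divide_le_eq)
  qed
  also have "\<dots> = exp (\<Sum>k=2..n. - a / real k)"
    by (simp add: exp_sum)
  also have "(\<Sum>k=2..n. - a / real k) = - a * (\<Sum>k=2..n. inverse (real k))"
    by (simp add: sum_distrib_left divide_inverse)
  also have "(\<Sum>k=2..n. inverse (real k)) = harm n - 1"
    using assms(3) by (simp add: harm_def sum.atLeast_Suc_atMost numeral_2_eq_2)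
  also have "exp (- a * (harm n - 1)) \<le> exp (1 - a * ln (real n))"
  proof -
    have "ln (real n) \<le> ln (real n + 1)" using assms by simp
    also have "\<dots> \<le> harm n" by (rule ln_le_harm)
    finally have "a * ln (real n) \<le> a * harm n" using assms by (intro mult_left_mono)
    then show ?thesis using assms by (simp add: algebra_simps)
  qed
  also have "\<dots> = exp 1 * real n powr (- a)"
    using assms by (simp add: powr_def exp_diff exp_minus field_simps)
  finally show ?thesis .
qed

text \<open>With \<open>h = \<epsilon> / 2\<close> the size of \<open>n\<close> bounds the power by
  \<open>n\<close> to the exponent \<open>h / (1 - h) * (u - \<epsilon>)\<close>, and the product
  contributes the exponent \<open>- (h * u)\<close>. As \<open>\<epsilon> = 2 * h\<close> and
  \<open>u \<le> 1\<close>, they add up to at most \<open>- (h * h)\<close>.\<close>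

lemma miss_probability_le:
  fixes \<epsilon> u :: real
  assumes \<epsilon>: "0 < \<epsilon>" "\<epsilon> < 1 / 2" and u: "1 / 2 \<le> u" "u \<le> 1"
    and n: "real n > exp (real d / (u - \<epsilon>))"
  shows "(1 / (1 - \<epsilon> / 2)) ^ d * (\<Prod>k=2..n. 1 - (1 - (1 - \<epsilon> / 2)) * u / real k)
    \<le> exp 1 * real n powr (- (\<epsilon>\<^sup>2 / 4))"
proof -
  define h where "h = \<epsilon> / 2"
  have h: "0 < h" "h < 1 / 4" using \<epsilon> by (auto simp: h_def)
  have "exp (real d / (u - \<epsilon>)) \<ge> 1" using \<epsilon> u by simp
  then have n1: "real n > 1" using n by linarith
  have hu: "0 \<le> h * u" "h * u \<le> 1" using h u mult_mono[of h 1 u 1] by auto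
  have d: "real d \<le> (u - \<epsilon>) * ln (real n)"
  proof -
    have "ln (exp (real d / (u - \<epsilon>))) < ln (real n)"
      using n n1 by (subst ln_less_cancel_iff) auto
    then have "real d / (u - \<epsilon>) < ln (real n)" by simp
    then have "real d < ln (real n) * (u - \<epsilon>)"
      using \<epsilon> u by (subst (asm) pos_divide_less_eq) auto
    then show ?thesis by (simp add: mult.commute)
  qed
  have "1 / (1 - h) \<le> exp (h / (1 - h))"
    using exp_ge_add_one_self[of "h / (1 - h)"] h by (simp add: field_simps)
  then have "(1 / (1 - h)) ^ d \<le> exp (h / (1 - h)) ^ d"
    using h by (intro power_mono) auto
  also have "\<dots> = exp (h / (1 - h) * real d)"
    by (subst mult.commute) (rule exp_of_nat_mult[symmetric])
  also have "\<dots> \<le> exp (h / (1 - h) * ((u - \<epsilon>) * ln (real n)))"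
    by (intro iffD2[OF exp_le_cancel_iff] mult_left_mono) (use d h in auto)
  also have "\<dots> = real n powr (h / (1 - h) * (u - \<epsilon>))"
    using n1 by (simp add: powr_def mult.assoc)
  finally have 1: "(1 / (1 - h)) ^ d \<le> real n powr (h / (1 - h) * (u - \<epsilon>))" .
  have "(\<Prod>k=2..n. 1 - h * u / real k) \<le> exp 1 * real n powr (- (h * u))"
    using n1 hu by (intro prod_one_minus_le) auto
  moreover have "(\<Prod>k=2..n. 1 - h * u / real k) \<ge> 0"
    using hu by (intro prod_nonneg) (auto simp: divide_le_eq)
  ultimately have "(1 / (1 - h)) ^ d * (\<Prod>k=2..n. 1 - h * u / real k)
      \<le> real n powr (h / (1 - h) * (u - \<epsilon>)) * (exp 1 * real n powr (- (h * u)))"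
    using 1 by (intro mult_mono) auto
  also have "\<dots> = exp 1 * real n powr (h / (1 - h) * (u - \<epsilon>) - h * u)"
    using n1 by (simp add: powr_diff powr_minus field_simps)
  also have "h / (1 - h) * (u - \<epsilon>) - h * u \<le> - (\<epsilon>\<^sup>2 / 4)"
  proof -
    have "h / (1 - h) * (u - \<epsilon>) - h * u = - (h * (2 * h - h * u) / (1 - h))"
      using h by (simp add: h_def field_simps)
    moreover have "h * h \<le> h * (2 * h - h * u)"
      using h u mult_left_mono[of u 1 h] by (intro mult_left_mono) auto
    moreover have "h * (2 * h - h * u) \<le> h * (2 * h - h * u) / (1 - h)"
      using h calculation(2) by (simp add: le_divide_eq mult_le_cancel_left1 mult_left_le)
    ultimately have "h / (1 - h) * (u - \<epsilon>) - h * u \<le> - (h * h)" by linarith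
    then show ?thesis by (simp add: h_def power2_eq_square)
  qed
  then have "exp 1 * real n powr (h / (1 - h) * (u - \<epsilon>) - h * u) \<le> exp 1 * real n powr (- (\<epsilon>\<^sup>2 / 4))"
    using n1 by simp
  finally show ?thesis by (simp add: h_def)
qed

section \<open>Convex hulls of indexed families and Abel summation\<close>

lemma in_conv_hull_mono:
  assumes "in_conv_hull d P x" "P \<subseteq> Q" "finite Q"
  shows "in_conv_hull d Q x"
proof -
  obtain w where w: "\<forall>p\<in>P. 0 \<le> w p" "sum w P = 1" "\<forall>j<d. (\<Sum>p\<in>P. w p * p j) = x j"
    using assms(1) unfolding in_conv_hull_def by blast
  define w' where "w' = (\<lambda>p. if p \<in> P then w p else 0)"
  have "sum w' Q = sum w P"
    unfolding w'_def using assms(2,3) by (simp add: sum.inter_restrict[symmetric] Int_absorb1)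
  moreover have "(\<Sum>p\<in>Q. w' p * p j) = (\<Sum>p\<in>P. w p * p j)" for j
  proof -
    have "(\<Sum>p\<in>Q. w' p * p j) = (\<Sum>p\<in>Q. if p \<in> P then w p * p j else 0)"
      by (rule sum.cong) (auto simp: w'_def)
    then show ?thesis
      using assms(2,3) by (simp add: sum.inter_restrict[symmetric] Int_absorb1)
  qed
  moreover have "\<forall>p\<in>Q. 0 \<le> w' p" using w(1) by (auto simp: w'_def)
  ultimately show ?thesis
    unfolding in_conv_hull_def using w(2,3) by (intro exI[of _ w']) simp
qed

text \<open>Different indices may give the same point. Forwards, the weight of a point goes to one
  representative index in \<open>U\<close>; backwards, the weights over each fibre of
  \<open>p\<close> are added.\<close>

lemma in_conv_hull_image_iff:
  fixes p :: "'i \<Rightarrow> nat \<Rightarrow> real"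
  assumes "finite K"
  shows "in_conv_hull d (p ` K) x \<longleftrightarrow>
    (\<exists>c. (\<forall>k\<in>K. 0 \<le> c k) \<and> sum c K = 1 \<and> (\<forall>j<d. (\<Sum>k\<in>K. c k * p k j) = x j))"
proof
  assume "in_conv_hull d (p ` K) x"
  then obtain w where w: "\<forall>q\<in>p ` K. 0 \<le> w q" "sum w (p ` K) = 1"
      "\<forall>j<d. (\<Sum>q\<in>p ` K. w q * q j) = x j"
    unfolding in_conv_hull_def by blast
  obtain U where U: "U \<subseteq> K" "inj_on p U" "p ` K = p ` U"
    using subset_image_inj[of "p ` K" p K] by auto
  define c where "c = (\<lambda>k. if k \<in> U then w (p k) else 0)"
  have "sum c K = sum w (p ` K)"
    unfolding c_def U(3) using U assms
    by (simp add: sum.inter_restrict[symmetric] Int_absorb1 sum.reindex)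
  moreover have "(\<Sum>k\<in>K. c k * p k j) = (\<Sum>q\<in>p ` K. w q * q j)" for j
  proof -
    have "(\<Sum>k\<in>K. c k * p k j) = (\<Sum>k\<in>K. if k \<in> U then w (p k) * p k j else 0)"
      by (rule sum.cong) (auto simp: c_def)
    then show ?thesis
      unfolding U(3) using U assms by (simp add: sum.inter_restrict[symmetric] Int_absorb1 sum.reindex)
  qed
  moreover have "\<forall>k\<in>K. 0 \<le> c k" using w(1) by (auto simp: c_def)
  ultimately show "\<exists>c. (\<forall>k\<in>K. 0 \<le> c k) \<and> sum c K = 1 \<and> (\<forall>j<d. (\<Sum>k\<in>K. c k * p k j) = x j)"
    using w by (intro exI[of _ c]) simp
next
  assume "\<exists>c. (\<forall>k\<in>K. 0 \<le> c k) \<and> sum c K = 1 \<and> (\<forall>j<d. (\<Sum>k\<in>K. c k * p k j) = x j)"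
  then obtain c where c: "\<forall>k\<in>K. 0 \<le> c k" "sum c K = 1" "\<forall>j<d. (\<Sum>k\<in>K. c k * p k j) = x j"
    by blast
  define w where "w = (\<lambda>q. \<Sum>k\<in>{k \<in> K. p k = q}. c k)"
  have "sum w (p ` K) = sum c K"
    unfolding w_def using assms by (rule sum.image_gen[symmetric])
  moreover have "(\<Sum>q\<in>p ` K. w q * q j) = (\<Sum>k\<in>K. c k * p k j)" for j
    unfolding sum.image_gen[OF assms, of "\<lambda>k. c k * p k j" p] w_def
    by (intro sum.cong) (auto simp: sum_distrib_right)
  moreover have "\<forall>q\<in>p ` K. 0 \<le> w q"
    unfolding w_def using c(1) by (auto intro: sum_nonneg)
  ultimately show "in_conv_hull d (p ` K) x"
    unfolding in_conv_hull_def using c by (intro exI[of _ w]) simp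
qed

lemma zero_in_conv_hullI:
  assumes "finite K" "\<And>k. k \<in> K \<Longrightarrow> 0 \<le> c k" "sum c K > 0"
    "\<And>j. j < d \<Longrightarrow> (\<Sum>k\<in>K. c k * p k j) = 0"
  shows "in_conv_hull d (p ` K) (\<lambda>_. 0)"
proof -
  have "(\<Sum>k\<in>K. c k / sum c K * p k j) = (\<Sum>k\<in>K. c k * p k j) / sum c K" for j
    by (simp add: sum_divide_distrib)
  then show ?thesis
    unfolding in_conv_hull_image_iff[OF assms(1)] using assms
    by (intro exI[of _ "\<lambda>k. c k / sum c K"]) (auto simp: sum_divide_distrib[symmetric])
qed

lemma abel_summation:
  fixes y \<eta> :: "nat \<Rightarrow> real"
  shows "(\<Sum>k=1..n. y k * \<eta> k) =
    (\<Sum>k=1..<n. (y k - y (Suc k)) * (\<Sum>i=1..k. \<eta> i)) + y n * (\<Sum>i=1..n. \<eta> i)"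
proof (induction n)
  case (Suc n)
  show ?case
  proof (cases "n = 0")
    case False
    then have "{1..<Suc n} = insert n {1..<n}" by auto
    with Suc show ?thesis by (simp add: algebra_simps)
  qed simp
qed simp

lemma sum_telescope_nat:
  fixes y :: "nat \<Rightarrow> real"
  assumes "n \<ge> 1"
  shows "(\<Sum>k=1..<n. y k - y (Suc k)) = y 1 - y n"
  using assms by (induction n rule: nat_induct_at_least) auto

section \<open>From absorbing arrangements to 0 in the hull\<close>

text \<open>Steps of the walk count from 1, list entries from 0. Off these positions it is the
  identity, as \<open>permutes\<close> demands.\<close>

definition perm_of :: "(nat \<times> real) list \<Rightarrow> nat \<Rightarrow> nat" where
  "perm_of L k = (if k \<in> {1..length L} then fst (L ! (k - 1)) else k)"

definition sign_of :: "(nat \<times> real) list \<Rightarrow> nat \<Rightarrow> real" where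
  "sign_of L k = snd (L ! (k - 1))"

lemma perm_of_permutes:
  assumes "is_arrangement b n L"
  shows "perm_of L permutes {1..n}"
proof (rule bij_imp_permutes)
  have len: "length L = n" and dis: "distinct (map fst L)" and fs: "fst ` set L = {1..n}"
    using assms by (auto simp: is_arrangement_def)
  have "bij_betw (\<lambda>k. k - 1) {1..n} {..<n}"
    by (rule bij_betwI[of _ _ _ Suc]) auto
  moreover have "bij_betw (\<lambda>k. map fst L ! k) {..<n} {1..n}"
    using bij_betw_nth[OF dis, of "{..<n}" "{1..n}"] len fs by simp
  ultimately have "bij_betw ((\<lambda>k. map fst L ! k) \<circ> (\<lambda>k. k - 1)) {1..n} {1..n}"
    by (rule bij_betw_trans)
  moreover have "bij_betw ((\<lambda>k. map fst L ! k) \<circ> (\<lambda>k. k - 1)) {1..n} {1..n}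
      \<longleftrightarrow> bij_betw (perm_of L) {1..n} {1..n}"
    by (intro bij_betw_cong) (auto simp: perm_of_def len)
  ultimately show "bij_betw (perm_of L) {1..n} {1..n}" by (rule iffD1[rotated])
  show "perm_of L x = x" if "x \<notin> {1..n}" for x
    using that len by (auto simp: perm_of_def)
qed

lemma sign_of_signs:
  assumes "is_arrangement b n L" "k \<in> {1..n}"
  shows "sign_of L k \<in> set (signs b)"
proof -
  have "L ! (k - 1) \<in> set L" using assms by (intro nth_mem) (auto simp: is_arrangement_def)
  then show ?thesis using assms by (auto simp: is_arrangement_def sign_of_def)
qed

lemma S_vec_signed_perm:
  assumes "k \<le> n" "j < d"
  shows "S_vec d (signed_perm n d \<sigma> e \<omega>) k j = (\<Sum>i=1..k. e i * \<omega> (\<sigma> i) j)"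
  unfolding S_vec_def using assms by (intro sum.cong) (auto simp: xi_vec_def signed_perm_def)

text \<open>\<open>y k\<close> is the signed value at position \<open>k\<close>, which puts the
  relation into the order of the walk; the signs cancel because they square to 1.\<close>

lemma absorbing_imp_weights:
  assumes L: "is_arrangement b n L" and absorbing: "absorbing b \<omega> {..<d} L" and n: "n \<ge> 1"
  obtains y where "\<And>k. 1 \<le> k \<Longrightarrow> k < n \<Longrightarrow> y (Suc k) \<le> y k"
    "if b then y n \<ge> 0 \<and> y 1 > 0 else y n < y 1"
    "\<And>j. j < d \<Longrightarrow> (\<Sum>k=1..n. y k * (sign_of L k * \<omega> (perm_of L k) j)) = 0"
proof -
  have len: "length L = n" using L by (simp add: is_arrangement_def)
  obtain x where x: "sorted_wrt (\<ge>) (vals b x L)"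
    "\<exists>p\<in>set (vals b x L). \<exists>q\<in>set (vals b x L). p \<noteq> q"
    "\<And>j. j < d \<Longrightarrow> (\<Sum>i=1..n. x i * \<omega> i j) = 0"
    using absorbing len unfolding absorbing_def by blast
  define y where "y = (\<lambda>k. sign_of L k * x (perm_of L k))"
  have y_nth: "vals b x L ! k = y (Suc k)" if "k < n" for k
    using that len by (simp add: vals_def nth_append y_def sign_of_def perm_of_def split: prod.splits)
  have lv: "length (vals b x L) = (if b then Suc n else n)"
    by (simp add: vals_def len)
  have mono: "vals b x L ! l \<le> vals b x L ! k" if "k \<le> l" "l < length (vals b x L)" for k l
    using x(1) that unfolding sorted_wrt_iff_nth_less by (cases "k = l") auto
  have last: "vals b x L ! n = 0" if b using that len by (simp add: vals_def nth_append)
  have first: "vals b x L ! 0 = y 1" using y_nth[of 0] n by simp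
  \<comment> \<open>A decreasing non-constant list drops strictly from its first to its last entry.
    In type B the last entry is the appended 0, whence \<open>y 1 > 0\<close>.\<close>
  have "vals b x L ! (length (vals b x L) - 1) < vals b x L ! 0"
  proof (rule ccontr)
    let ?l = "length (vals b x L) - 1"
    assume a: "\<not> vals b x L ! ?l < vals b x L ! 0"
    have "vals b x L ! k = vals b x L ! 0" if "k < length (vals b x L)" for k
    proof -
      have "k \<le> ?l" "?l < length (vals b x L)" using that by auto
      then show ?thesis using mono[of 0 k] mono[of k ?l] that a by linarith
    qed
    then show False using x(2) by (metis in_set_conv_nth)
  qed
  then have strict: "if b then y n \<ge> 0 \<and> y 1 > 0 else y n < y 1"
    using lv last first y_nth[of "n - 1"] mono[of "n - 1" n] n by (auto split: if_splits)
  have dec: "y (Suc k) \<le> y k" if "1 \<le> k" "k < n" for k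
    using mono[of "k - 1" k] y_nth[of "k - 1"] y_nth[of k] that lv by (auto split: if_splits)
  have "(\<Sum>k=1..n. y k * (sign_of L k * \<omega> (perm_of L k) j)) = 0" if "j < d" for j
  proof -
    have "(\<Sum>k=1..n. y k * (sign_of L k * \<omega> (perm_of L k) j))
        = (\<Sum>k=1..n. x (perm_of L k) * \<omega> (perm_of L k) j)"
    proof (rule sum.cong[OF refl])
      fix k assume "k \<in> {1..n}"
      then have "sign_of L k * sign_of L k = 1"
        using sign_of_signs[OF L, of k] by (auto simp: signs_def split: if_splits)
      then show "y k * (sign_of L k * \<omega> (perm_of L k) j) = x (perm_of L k) * \<omega> (perm_of L k) j"
        by (simp add: y_def)
    qed
    also have "\<dots> = (\<Sum>i=1..n. x i * \<omega> i j)"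
      using sum.permute[OF perm_of_permutes[OF L], of "\<lambda>i. x i * \<omega> i j"] by (simp add: o_def)
    finally show ?thesis using x(3)[OF that] by simp
  qed
  with that strict dec show ?thesis by blast
qed

text \<open>Abel summation, with the value after position \<open>n\<close> read as 0, yields the
  nonnegative weights \<open>c\<close>, whose total is \<open>y 1 > 0\<close>.\<close>

lemma absorbing_imp_zero_in_hull_B:
  assumes L: "is_arrangement True n L" and absorbing: "absorbing True \<omega> {..<d} L" and n: "n \<ge> 1"
  shows "in_conv_hull d (S_vec d (signed_perm n d (perm_of L) (sign_of L) \<omega>) ` {1..n}) (\<lambda>_. 0)"
proof -
  obtain y where y: "\<And>k. 1 \<le> k \<Longrightarrow> k < n \<Longrightarrow> y (Suc k) \<le> y k" "y n \<ge> 0 \<and> y 1 > 0"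
    "\<And>j. j < d \<Longrightarrow> (\<Sum>k=1..n. y k * (sign_of L k * \<omega> (perm_of L k) j)) = 0"
    using absorbing_imp_weights[OF L absorbing n] by (metis (full_types))
  define c where "c = (\<lambda>k. if k = n then y n else y k - y (Suc k))"
  have I: "{1..n} = insert n {1..<n}" using n by auto
  have c: "(\<Sum>k=1..n. c k * g k) = (\<Sum>k=1..<n. (y k - y (Suc k)) * g k) + y n * g n" for g
    unfolding I by (simp add: c_def)
  show ?thesis
  proof (rule zero_in_conv_hullI[where c = c])
    show "0 \<le> c k" if "k \<in> {1..n}" for k
      using that y by (auto simp: c_def)
    show "sum c {1..n} > 0"
      using c[of "\<lambda>_. 1"] sum_telescope_nat[OF n, of y] y(2) by simp
    show "(\<Sum>k=1..n. c k * S_vec d (signed_perm n d (perm_of L) (sign_of L) \<omega>) k j) = 0" if "j < d" for j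
    proof -
      have "(\<Sum>k=1..n. c k * S_vec d (signed_perm n d (perm_of L) (sign_of L) \<omega>) k j)
          = (\<Sum>k=1..n. c k * (\<Sum>i=1..k. sign_of L i * \<omega> (perm_of L i) j))"
        using that by (intro sum.cong) (simp_all add: S_vec_signed_perm)
      also have "\<dots> = (\<Sum>k=1..n. y k * (sign_of L k * \<omega> (perm_of L k) j))"
        unfolding c by (rule abel_summation[symmetric])
      finally show ?thesis using y(3)[OF that] by simp
    qed
  qed simp
qed

text \<open>The boundary term of Abel summation vanishes because the total sum is 0 in every order,
  so only the first \<open>n - 1\<close> partial sums remain, with total weight
  \<open>y 1 - y n > 0\<close>.\<close>

lemma absorbing_imp_zero_in_hull_A:
  assumes L: "is_arrangement False n L" and absorbing: "absorbing False \<omega> {..<d} L" and n: "n \<ge> 1"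
    and S: "S_vec d \<omega> n = (\<lambda>_. 0)"
  shows "in_conv_hull d (S_vec d (signed_perm n d (perm_of L) (\<lambda>_. 1) \<omega>) ` {1..n-1}) (\<lambda>_. 0)"
proof -
  obtain y where y: "\<And>k. 1 \<le> k \<Longrightarrow> k < n \<Longrightarrow> y (Suc k) \<le> y k" "y n < y 1"
    "\<And>j. j < d \<Longrightarrow> (\<Sum>k=1..n. y k * (sign_of L k * \<omega> (perm_of L k) j)) = 0"
    using absorbing_imp_weights[OF L absorbing n] by (metis (full_types))
  have I: "{1..n-1} = {1..<n}" using n by auto
  have sgn: "sign_of L k = 1" if "k \<in> {1..n}" for k
    using sign_of_signs[OF L that] by (simp add: signs_def)
  show ?thesis
  proof (rule zero_in_conv_hullI[where c = "\<lambda>k. y k - y (Suc k)"])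
    show "0 \<le> y k - y (Suc k)" if "k \<in> {1..n-1}" for k
      using that y(1)[of k] by auto
    show "(\<Sum>k=1..n-1. y k - y (Suc k)) > 0"
      unfolding I using sum_telescope_nat[OF n, of y] y(2) by simp
    show "(\<Sum>k=1..n-1. (y k - y (Suc k)) * S_vec d (signed_perm n d (perm_of L) (\<lambda>_. 1) \<omega>) k j) = 0"
      if "j < d" for j
    proof -
      have "(\<Sum>i=1..n. \<omega> (perm_of L i) j) = (\<Sum>i=1..n. \<omega> i j)"
        using sum.permute[OF perm_of_permutes[OF L], of "\<lambda>i. \<omega> i j"] by (simp add: o_def)
      also have "\<dots> = S_vec d \<omega> n j"
        unfolding S_vec_def using that by (simp add: xi_vec_def)
      finally have 0: "(\<Sum>i=1..n. \<omega> (perm_of L i) j) = 0" using S by simp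
      have "(\<Sum>k=1..n. y k * \<omega> (perm_of L k) j) = (\<Sum>k=1..n. y k * (sign_of L k * \<omega> (perm_of L k) j))"
        by (rule sum.cong) (auto simp: sgn)
      then have "(\<Sum>k=1..n. y k * \<omega> (perm_of L k) j) = 0" using y(3)[OF that] by simp
      then have "(\<Sum>k=1..<n. (y k - y (Suc k)) * (\<Sum>i=1..k. \<omega> (perm_of L i) j)) = 0"
        unfolding abel_summation 0 by simp
      moreover have "(\<Sum>k=1..<n. (y k - y (Suc k)) * S_vec d (signed_perm n d (perm_of L) (\<lambda>_. 1) \<omega>) k j)
          = (\<Sum>k=1..<n. (y k - y (Suc k)) * (\<Sum>i=1..k. \<omega> (perm_of L i) j))"
        using that by (intro sum.cong) (simp_all add: S_vec_signed_perm)
      ultimately show ?thesis unfolding I by simp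
    qed
  qed simp
qed

text \<open>Hence the type D hull does not see the sign of the last step, and averaging over even sign
  changes is the same as averaging over all of them.\<close>

lemma hull_points_D_flip:
  assumes "n \<ge> 1"
  shows "hull_points TypeD d n (signed_perm n d \<sigma> (e(n := - e n)) \<omega>)
       = hull_points TypeD d n (signed_perm n d \<sigma> e \<omega>)"
proof -
  let ?a = "signed_perm n d \<sigma> e \<omega>" and ?b = "signed_perm n d \<sigma> (e(n := - e n)) \<omega>"
  have xi: "xi_vec d ?b i = xi_vec d ?a i" if "i < n" for i
    using that by (auto simp: xi_vec_def signed_perm_def fun_eq_iff)
  have xn: "xi_vec d ?b n j = - xi_vec d ?a n j" for j
    using assms by (auto simp: xi_vec_def signed_perm_def)
  have S: "S_vec d ?b k = S_vec d ?a k" if "k < n" for k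
    unfolding S_vec_def using that xi by (auto intro!: ext sum.cong)
  have Sn: "S_vec d w n = (\<lambda>j. S_vec d w (n - 1) j + xi_vec d w n j)" for w
    using assms by (cases n) (auto simp: S_vec_def)
  \<comment> \<open>Reversing the last step exchanges the final partial sum with
    \<open>Sstar_vec\<close> and keeps all earlier points.\<close>
  have 1: "S_vec d ?b n = Sstar_vec d n ?a"
    unfolding Sn[of ?b] Sstar_vec_def using S[of "n - 1"] assms by (simp add: xn)
  have 2: "Sstar_vec d n ?b = S_vec d ?a n"
    unfolding Sn[of ?a] Sstar_vec_def using S[of "n - 1"] assms by (simp add: xn)
  have I: "{1..n} = insert n {1..<n}" using assms by auto
  have "S_vec d ?b ` {1..<n} = S_vec d ?a ` {1..<n}"
    using S by (intro image_cong) auto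
  then show ?thesis
    unfolding hull_points_def rtype.case I image_insert 1 2 by blast
qed

lemma absorbing_imp_zero_in_hull_D:
  assumes L: "is_arrangement True n L" and absorbing: "absorbing True \<omega> {..<d} L" and n: "n \<ge> 1"
  shows "in_conv_hull d (hull_points TypeD d n (signed_perm n d (perm_of L) (sign_of L) \<omega>)) (\<lambda>_. 0)"
  by (rule in_conv_hull_mono[OF absorbing_imp_zero_in_hull_B[OF assms]]) (auto simp: hull_points_def)

section \<open>Measurability of the hull event\<close>

text \<open>This turns an uncountable union of events into countable operations.\<close>

lemma weights_iff_rational_approx:
  fixes p :: "'i \<Rightarrow> nat \<Rightarrow> real"
  assumes K: "finite K"
  shows "(\<exists>c. (\<forall>k\<in>K. 0 \<le> c k) \<and> sum c K = 1 \<and> (\<forall>j<d. (\<Sum>k\<in>K. c k * p k j) = 0)) \<longleftrightarrow>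
    (\<forall>m::nat. \<exists>q\<in>PiE K (\<lambda>_. \<rat> \<inter> {0..2}). \<bar>sum q K - 1\<bar> \<le> 1 / real (Suc m) \<and>
       (\<forall>j<d. \<bar>\<Sum>k\<in>K. q k * p k j\<bar> \<le> 1 / real (Suc m)))"
    (is "?L \<longleftrightarrow> (\<forall>m. \<exists>q\<in>?Q. ?R m q)")
proof (intro iffI allI)
  fix m
  assume ?L
  then obtain c where c: "\<forall>k\<in>K. 0 \<le> c k" "sum c K = 1" "\<forall>j<d. (\<Sum>k\<in>K. c k * p k j) = 0"
    by blast
  \<comment> \<open>One error budget for all sums: each summand dominates both coefficients in
    question, 1 for the total weight and \<open>p k j\<close> for the coordinates.\<close>
  define B where "B = 1 + (\<Sum>k\<in>K. 1 + (\<Sum>j<d. \<bar>p k j\<bar>))"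
  have B: "B \<ge> 1" unfolding B_def by (auto intro!: sum_nonneg add_nonneg_nonneg)
  define \<eta> where "\<eta> = 1 / (real (Suc m) * B)"
  have \<eta>: "\<eta> > 0" "\<eta> \<le> 1" "\<eta> * B = 1 / real (Suc m)"
  proof -
    have "1 * 1 \<le> real (Suc m) * B" using B by (intro mult_mono) auto
    then show "\<eta> > 0" "\<eta> \<le> 1" "\<eta> * B = 1 / real (Suc m)"
      using B by (auto simp: \<eta>_def divide_le_eq)
  qed
  \<comment> \<open>Approximation from above keeps the weights nonnegative;
    \<open>c k \<le> 1\<close> and \<open>\<eta> \<le> 1\<close> explain the cap 2.\<close>
  have "\<exists>r\<in>\<rat>. c k < r \<and> r < c k + \<eta>" for k
    using Rats_dense_in_real[of "c k" "c k + \<eta>"] \<eta> by auto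
  then obtain r where r: "\<And>k. r k \<in> \<rat>" "\<And>k. c k < r k" "\<And>k. r k < c k + \<eta>"
    by metis
  define q where "q = restrict r K"
  have c1: "c k \<le> 1" if "k \<in> K" for k
    using member_le_sum[of k K c] c K that by auto
  have q: "q \<in> ?Q"
    unfolding q_def restrict_PiE_iff
  proof
    fix k assume k: "k \<in> K"
    have "0 \<le> r k" using c(1) k r(2)[of k] by force
    moreover have "r k \<le> 2" using c1[OF k] r(3)[of k] \<eta>(2) by linarith
    ultimately show "r k \<in> \<rat> \<inter> {0..2}" using r(1) by auto
  qed
  have bound: "\<bar>(\<Sum>k\<in>K. q k * a k) - (\<Sum>k\<in>K. c k * a k)\<bar> \<le> 1 / real (Suc m)"
    if a: "\<And>k. k \<in> K \<Longrightarrow> \<bar>a k\<bar> \<le> 1 + (\<Sum>j<d. \<bar>p k j\<bar>)" for a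
  proof -
    have "\<bar>(\<Sum>k\<in>K. q k * a k) - (\<Sum>k\<in>K. c k * a k)\<bar> = \<bar>\<Sum>k\<in>K. (q k - c k) * a k\<bar>"
      by (simp add: sum_subtractf left_diff_distrib)
    also have "\<dots> \<le> (\<Sum>k\<in>K. \<eta> * (1 + (\<Sum>j<d. \<bar>p k j\<bar>)))"
    proof (rule order_trans[OF sum_abs sum_mono])
      fix k assume k: "k \<in> K"
      have "\<bar>q k - c k\<bar> \<le> \<eta>"
        using r(2)[of k] r(3)[of k] k by (simp add: q_def)
      then show "\<bar>(q k - c k) * a k\<bar> \<le> \<eta> * (1 + (\<Sum>j<d. \<bar>p k j\<bar>))"
        unfolding abs_mult using a[OF k] \<eta> by (intro mult_mono) auto
    qed
    also have "\<dots> \<le> \<eta> * B"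
      unfolding B_def sum_distrib_left[symmetric] using \<eta> by (intro mult_left_mono) auto
    finally show ?thesis using \<eta> by simp
  qed
  have "\<bar>sum q K - 1\<bar> \<le> 1 / real (Suc m)"
    using bound[of "\<lambda>_. 1"] c(2) by (auto simp: sum_nonneg)
  moreover have "\<bar>\<Sum>k\<in>K. q k * p k j\<bar> \<le> 1 / real (Suc m)" if "j < d" for j
  proof -
    have "\<bar>p k j\<bar> \<le> (\<Sum>j<d. \<bar>p k j\<bar>)" for k
      using that by (intro member_le_sum) auto
    then have "\<bar>p k j\<bar> \<le> 1 + (\<Sum>j<d. \<bar>p k j\<bar>)" for k
      by (simp add: add_increasing)
    then show ?thesis using bound[of "\<lambda>k. p k j"] c(3) that by simp
  qed
  ultimately show "\<exists>q\<in>?Q. ?R m q" using q by blast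
next
  assume R: "\<forall>m. \<exists>q\<in>?Q. ?R m q"
  \<comment> \<open>Conversely, by compactness: \<open>g\<close> measures the violation of the
    equations and attains its minimum on \<open>S\<close>, whose factors off \<open>K\<close> are
    the point 0. The approximations force this minimum to be 0.\<close>
  define S where "S = PiE UNIV (\<lambda>k. if k \<in> K then {0..2::real} else {0})"
  define g where "g = (\<lambda>c. \<bar>sum c K - 1\<bar> + (\<Sum>j<d. \<bar>\<Sum>k\<in>K. c k * p k j\<bar>))"
  have "compactin (product_topology (\<lambda>_. euclidean) UNIV) S"
    unfolding S_def compactin_PiE by auto
  then have "compact S"
    by (simp add: euclidean_product_topology)
  moreover have "S \<noteq> {}"
    unfolding S_def by (auto simp: PiE_eq_empty_iff)
  moreover have "continuous_on S g"
    unfolding g_def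
    by (intro continuous_intros continuous_on_subset[OF continuous_on_product_coordinates]) auto
  ultimately obtain c where c: "c \<in> S" "\<And>c'. c' \<in> S \<Longrightarrow> g c \<le> g c'"
    using continuous_attains_inf by metis
  have le: "g c \<le> (1 + real d) * (1 / real (Suc m))" for m
  proof -
    obtain q where q: "q \<in> ?Q" "?R m q" using R by blast
    define q' where "q' = (\<lambda>k. if k \<in> K then q k else 0)"
    have "q' \<in> S" using q(1) by (auto simp: S_def q'_def PiE_def Pi_def)
    then have "g c \<le> g q'" by (rule c(2))
    also have "g q' = \<bar>sum q K - 1\<bar> + (\<Sum>j<d. \<bar>\<Sum>k\<in>K. q k * p k j\<bar>)"
      unfolding g_def q'_def by simp
    also have "\<dots> \<le> 1 / real (Suc m) + (\<Sum>j<d. 1 / real (Suc m))"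
      using q(2) by (intro add_mono sum_mono) auto
    also have "\<dots> = (1 + real d) * (1 / real (Suc m))"
      by (simp add: add_divide_distrib del: of_nat_Suc)
    finally show ?thesis .
  qed
  have "(\<lambda>m. (1 + real d) * (1 / real (Suc m))) \<longlonglongrightarrow> (1 + real d) * 0"
    by (intro tendsto_mult tendsto_const LIMSEQ_Suc lim_1_over_n)
  then have "g c \<le> (1 + real d) * 0"
    by (rule LIMSEQ_le_const) (use le in blast)
  moreover have "0 \<le> (\<Sum>j<d. \<bar>\<Sum>k\<in>K. c k * p k j\<bar>)" by (intro sum_nonneg) auto
  ultimately have 0: "\<bar>sum c K - 1\<bar> = 0" "(\<Sum>j<d. \<bar>\<Sum>k\<in>K. c k * p k j\<bar>) = 0"
    unfolding g_def by linarith+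
  have "\<forall>j<d. (\<Sum>k\<in>K. c k * p k j) = 0"
    using 0(2) by (subst (asm) sum_nonneg_eq_0_iff) auto
  moreover have "\<forall>k\<in>K. 0 \<le> c k"
    using PiE_mem[OF c(1)[unfolded S_def]] by (metis UNIV_I atLeastAtMost_iff)
  ultimately show ?L using 0(1) by (intro exI[of _ c]) simp
qed

lemma measurable_zero_in_conv_hull:
  fixes p :: "'w \<Rightarrow> 'i \<Rightarrow> nat \<Rightarrow> real"
  assumes K: "finite K" and p: "\<And>k j. k \<in> K \<Longrightarrow> j < d \<Longrightarrow> (\<lambda>\<omega>. p \<omega> k j) \<in> borel_measurable M"
  shows "{\<omega> \<in> space M. in_conv_hull d (p \<omega> ` K) (\<lambda>_. 0)} \<in> sets M"
proof -
  have cnt: "countable (PiE K (\<lambda>_. \<rat> \<inter> {0..2::real}))"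
    using K by (intro countable_PiE) (auto simp: countable_rat countable_Int1)
  have ball: "(\<forall>j<d. R j) \<longleftrightarrow> (\<forall>j\<in>{..<d}. R j)" for R :: "nat \<Rightarrow> bool"
    by auto
  show ?thesis
    unfolding in_conv_hull_image_iff[OF K] weights_iff_rational_approx[OF K]
    unfolding ball
    by (intro sets.sets_Collect_countable_All sets.sets_Collect_countable_Ex'[OF _ cnt]
        sets.sets_Collect_conj sets.sets_Collect_const sets.sets_Collect_countable_All'
        borel_measurable_le borel_measurable_abs borel_measurable_sum borel_measurable_times
        borel_measurable_const p) auto
qed

lemma coord_measurable:
  assumes "i \<in> {1..n}" "j < d"
  shows "(\<lambda>\<omega>. \<omega> i j) \<in> borel_measurable (tuple_space n d)"
proof -
  have "(\<lambda>\<omega>. \<omega> i) \<in> measurable (tuple_space n d) (PiM {..<d} (\<lambda>_. borel :: real measure))"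
    unfolding tuple_space_def using assms by (intro measurable_component_singleton)
  moreover have "(\<lambda>x. x j) \<in> measurable (PiM {..<d} (\<lambda>_. borel :: real measure)) borel"
    using assms by (intro measurable_component_singleton) auto
  ultimately show ?thesis by (rule measurable_compose)
qed

lemma signed_perm_measurable:
  assumes "\<sigma> permutes {1..n}"
  shows "signed_perm n d \<sigma> e \<in> measurable (tuple_space n d) (tuple_space n d)"
proof -
  have "signed_perm n d \<sigma> e \<in> measurable (tuple_space n d) (PiM {1..n} (\<lambda>_. PiM {..<d} (\<lambda>_. borel)))"
    unfolding signed_perm_def
    by (intro measurable_restrict borel_measurable_times borel_measurable_const coord_measurable)
       (use permutes_in_image[OF assms] in auto)
  then show ?thesis by (simp add: tuple_space_def)
qed

lemma S_vec_measurable: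
  assumes "k \<le> n" "j < d"
  shows "(\<lambda>\<omega>. S_vec d \<omega> k j) \<in> borel_measurable (tuple_space n d)"
  unfolding S_vec_def xi_vec_def using assms
  by (auto intro!: borel_measurable_sum coord_measurable)

lemma hull_event_measurable:
  assumes "n \<ge> 1"
  shows "{\<omega> \<in> space (tuple_space n d). in_conv_hull d (hull_points t d n \<omega>) (\<lambda>_. 0)} \<in> sets (tuple_space n d)"
proof (cases t)
  case TypeA
  then show ?thesis unfolding hull_points_def rtype.case
    by simp (intro measurable_zero_in_conv_hull, auto intro!: S_vec_measurable)
next
  case TypeB
  then show ?thesis unfolding hull_points_def rtype.case
    by simp (intro measurable_zero_in_conv_hull, auto intro!: S_vec_measurable)
next
  case TypeD
  \<comment> \<open>Index 0 stands for the extra point, so that the hull is again that of an indexed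
    family.\<close>
  define p where "p = (\<lambda>\<omega> k. if k = 0 then Sstar_vec d n \<omega> else S_vec d \<omega> k)"
  have "(\<lambda>\<omega>. p \<omega> k j) \<in> borel_measurable (tuple_space n d)" if "k \<in> {0..n}" "j < d" for k j
    using that assms unfolding p_def Sstar_vec_def xi_vec_def
    by (cases "k = 0") (auto intro!: borel_measurable_diff S_vec_measurable coord_measurable)
  then have "{\<omega> \<in> space (tuple_space n d). in_conv_hull d (p \<omega> ` {0..n}) (\<lambda>_. 0)} \<in> sets (tuple_space n d)"
    by (intro measurable_zero_in_conv_hull) auto
  moreover have "p \<omega> ` {0..n} = hull_points TypeD d n \<omega>" for \<omega>
  proof -
    have "{0..n} = insert 0 {1..n}" by auto
    moreover have "p \<omega> ` {1..n} = S_vec d \<omega> ` {1..n}"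
      by (rule image_cong) (auto simp: p_def)
    ultimately show ?thesis by (simp add: hull_points_def) (simp add: p_def)
  qed
  ultimately show ?thesis using TypeD by simp
qed

section \<open>Averaging over the symmetry group\<close>

lemma length_arrangements_pos: "0 < length (arrangements b n)"
proof (induction n)
  case (Suc n)
  have "0 < real (length (arrangements b (Suc n)))"
    unfolding length_arrangements_Suc using Suc by (auto simp: sign_rate_def intro!: mult_pos_pos divide_pos_pos)
  then show ?case by linarith
qed simp

text \<open>The expected number of events that occur is \<open>length xs * p\<close>, and
  integrating the almost sure bound compares it with \<open>length xs * c\<close>.\<close>

lemma prob_ge_of_count:
  assumes P: "prob_space P" and E: "\<And>L. L \<in> set xs \<Longrightarrow> E L \<in> sets P"
    and p: "\<And>L. L \<in> set xs \<Longrightarrow> measure P (E L) = p"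
    and xs: "length xs > 0"
    and ae: "AE \<omega> in P. (\<Sum>L\<leftarrow>xs. of_bool (\<omega> \<in> E L)) \<ge> real (length xs) * c"
  shows "p \<ge> c"
proof -
  interpret prob_space P by fact
  have eq: "(\<Sum>L\<leftarrow>xs. of_bool (\<omega> \<in> E L)) = (\<Sum>i<length xs. indicator (E (xs ! i)) \<omega> :: real)" for \<omega>
    by (simp add: sum_list_sum_nth atLeast0LessThan indicator_def of_bool_def)
  have "real (length xs) * c \<le> (\<integral>\<omega>. (\<Sum>i<length xs. indicator (E (xs ! i)) \<omega>) \<partial>P)"
    using ae E unfolding eq
    by (intro integral_ge_const Bochner_Integration.integrable_sum integrable_real_indicator)
       (auto simp: emeasure_eq_measure)
  also have "\<dots> = (\<Sum>i<length xs. measure P (E (xs ! i)))"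
    using E by (subst Bochner_Integration.integral_sum)
      (auto simp: emeasure_eq_measure intro!: integrable_real_indicator sum.cong)
  also have "\<dots> = real (length xs) * p"
    using p by simp
  finally show ?thesis using xs by simp
qed

lemma prob_zero_in_hull_ge:
  fixes \<epsilon> :: real and P :: "(nat \<Rightarrow> nat \<Rightarrow> real) measure"
  assumes \<epsilon>: "0 < \<epsilon>" "\<epsilon> < 1/2" and n: "real n > exp (real d / (u_of t - \<epsilon>))"
    and P: "prob_space P" and sets: "sets P = sets (tuple_space n d)" and t: "type_assms t d n P"
  shows "measure P {\<omega> \<in> space P. in_conv_hull d (hull_points t d n \<omega>) (\<lambda>_. 0)}
    \<ge> 1 - exp 1 * real n powr (- (\<epsilon>\<^sup>2 / 4))"
proof -
  define b where "b = (t \<noteq> TypeA)"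
  have u: "sign_rate b = u_of t" "1/2 \<le> u_of t" "u_of t \<le> 1"
    by (auto simp: sign_rate_def u_of_def b_def)
  have "exp (real d / (u_of t - \<epsilon>)) \<ge> 1" using \<epsilon> u by simp
  then have n1: "n \<ge> 1" using n by linarith
  have space: "space P = space (tuple_space n d)" using sets by (rule sets_eq_imp_space_eq)
  define H where "H = {\<omega> \<in> space (tuple_space n d). in_conv_hull d (hull_points t d n \<omega>) (\<lambda>_. 0)}"
  have H: "H \<in> sets (tuple_space n d)"
    unfolding H_def using n1 by (rule hull_event_measurable)
  \<comment> \<open>Each arrangement acts on the tuple by \<open>T L\<close>; by invariance of the
    law, every event \<open>E L\<close> will have the probability of \<open>H\<close>.\<close>
  define T where "T = (\<lambda>L. signed_perm n d (perm_of L) (if b then sign_of L else (\<lambda>_. 1)))"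
  define E where "E = (\<lambda>L. T L -` H \<inter> space P)"
  have meas: "signed_perm n d \<sigma> e \<in> measurable P (tuple_space n d)" if "\<sigma> permutes {1..n}" for \<sigma> e
    using signed_perm_measurable[OF that] by (simp add: measurable_cong_sets[OF sets refl])
  have inv: "measure P (signed_perm n d \<sigma> e -` H \<inter> space P) = measure P H"
    if "\<sigma> permutes {1..n}" "distr P (tuple_space n d) (signed_perm n d \<sigma> e) = P" for \<sigma> e
    using measure_distr[OF meas[OF that(1), of e] H] that(2) by simp
  have E_sets: "E L \<in> sets P" if "L \<in> set (arrangements b n)" for L
    unfolding E_def T_def
    by (rule measurable_sets[OF meas[OF perm_of_permutes[OF arrangements_is_arrangement[OF that]]] H])
  have E_prob: "measure P (E L) = measure P H" if "L \<in> set (arrangements b n)" for L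
  proof -
    have L: "is_arrangement b n L" using that by (rule arrangements_is_arrangement)
    note \<sigma> = perm_of_permutes[OF L]
    have sgn: "sign_of L i \<in> {-1, 1}" if "i \<in> {1..n}" for i
      using sign_of_signs[OF L that] by (auto simp: signs_def split: if_splits)
    show ?thesis
    proof (cases t)
      case TypeA
      then show ?thesis
        using t \<sigma> inv unfolding E_def T_def b_def type_assms_def by simp
    next
      case TypeB
      then show ?thesis
        using t \<sigma> sgn inv unfolding E_def T_def b_def type_assms_def by simp
    next
      case TypeD
      \<comment> \<open>Type D invariance covers only sign changes with product 1. If the product is
        -1, flipping the last sign repairs it and leaves the hull unchanged.\<close>
      define e' where "e' = (sign_of L)(n := - sign_of L n)"
      have D: "distr P (tuple_space n d) (signed_perm n d (perm_of L) e) = P"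
        if "\<forall>i\<in>{1..n}. e i \<in> {-1, 1}" "(\<Prod>i\<in>{1..n}. e i) = 1" for e
        using t TypeD \<sigma> that unfolding type_assms_def by simp
      have TD: "T L = signed_perm n d (perm_of L) (sign_of L)"
        using TypeD by (simp add: T_def b_def)
      have "(\<Prod>i\<in>I. sign_of L i) \<in> {-1, 1}" if "I \<subseteq> {1..n}" "finite I" for I
        using that(2,1)
      proof (induction I rule: finite_induct)
        case (insert i I)
        then have "sign_of L i \<in> {-1, 1}" using sgn by auto
        with insert show ?case by auto
      qed simp
      then have "(\<Prod>i\<in>{1..n}. sign_of L i) \<in> {-1, 1}" by blast
      then consider "(\<Prod>i\<in>{1..n}. sign_of L i) = 1" | "(\<Prod>i\<in>{1..n}. sign_of L i) = -1"
        by blast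
      then show ?thesis
      proof cases
        case 1
        then show ?thesis unfolding E_def TD using sgn D \<sigma> by (intro inv) auto
      next
        case 2
        have I: "{1..n} = insert n {1..<n}" using n1 by auto
        have "(\<Prod>i\<in>{1..<n}. e' i) = (\<Prod>i\<in>{1..<n}. sign_of L i)"
          by (rule prod.cong) (auto simp: e'_def)
        then have prod: "(\<Prod>i\<in>{1..n}. e' i) = 1" using 2 unfolding I by (simp add: e'_def)
        have sgn': "\<forall>i\<in>{1..n}. e' i \<in> {-1, 1}" using sgn by (force simp: e'_def)
        have sp: "signed_perm n d (perm_of L) e \<omega> \<in> space (tuple_space n d)" if "\<omega> \<in> space P" for e \<omega>
          using meas[OF \<sigma>] that by (rule measurable_space)
        have "E L = signed_perm n d (perm_of L) e' -` H \<inter> space P"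
          unfolding E_def TD H_def e'_def using sp hull_points_D_flip[OF n1] TypeD by auto
        then show ?thesis using inv[OF \<sigma> D[OF sgn' prod]] by simp
      qed
    qed
  qed
  \<comment> \<open>The exceptional null set comes from type A, where the walk returns to 0 only
    almost surely.\<close>
  have hit: "AE \<omega> in P. \<forall>L\<in>set (arrangements b n). absorbing b \<omega> {..<d} L \<longrightarrow> \<omega> \<in> E L"
  proof -
    have sp: "T L \<omega> \<in> space (tuple_space n d)" if "L \<in> set (arrangements b n)" "\<omega> \<in> space P" for L \<omega>
      unfolding T_def using meas[OF perm_of_permutes[OF arrangements_is_arrangement[OF that(1)]]] that(2)
      by (rule measurable_space)
    have "AE \<omega> in P. t = TypeA \<longrightarrow> S_vec d \<omega> n = (\<lambda>_. 0)"
      using t by (cases t) (auto simp: type_assms_def)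
    then show ?thesis using AE_space
    proof eventually_elim
      case (elim \<omega>)
      show ?case
      proof (intro ballI impI)
        fix L assume L: "L \<in> set (arrangements b n)" and absorbing: "absorbing b \<omega> {..<d} L"
        note La = arrangements_is_arrangement[OF L]
        have "in_conv_hull d (hull_points t d n (T L \<omega>)) (\<lambda>_. 0)"
        proof (cases t)
          case TypeA
          then show ?thesis
            using absorbing_imp_zero_in_hull_A[of n L \<omega> d] La absorbing n1 elim
            by (simp add: hull_points_def T_def b_def)
        next
          case TypeB
          then show ?thesis
            using absorbing_imp_zero_in_hull_B[of n L \<omega> d] La absorbing n1
            by (simp add: hull_points_def T_def b_def)
        next
          case TypeD
          then show ?thesis
            using absorbing_imp_zero_in_hull_D[of n L \<omega> d] La absorbing n1
            by (simp add: T_def b_def)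
        qed
        then show "\<omega> \<in> E L"
          unfolding E_def H_def using sp[OF L elim(2)] elim(2) by simp
      qed
    qed
  qed
  define z where "z = 1 - \<epsilon> / 2"
  define c where "c = (1/z) ^ d * (\<Prod>k=2..n. 1 - (1 - z) * sign_rate b / real k)"
  have z: "0 < z" "z < 1" using \<epsilon> by (auto simp: z_def)
  have "AE \<omega> in P. (\<Sum>L\<leftarrow>arrangements b n. of_bool (\<omega> \<in> E L)) \<ge> real (length (arrangements b n)) * (1 - c)"
    using hit
  proof eventually_elim
    case (elim \<omega>)
    have "real (length (arrangements b n)) * (1 - c) \<le> (\<Sum>L\<leftarrow>arrangements b n. of_bool (absorbing b \<omega> {..<d} L))"
      using count_absorbing_arrangements[OF z, of "{..<d}" b n \<omega>] by (simp add: c_def)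
    also have "\<dots> \<le> (\<Sum>L\<leftarrow>arrangements b n. of_bool (\<omega> \<in> E L))"
      using elim by (intro sum_list_mono) auto
    finally show ?case .
  qed
  then have "measure P H \<ge> 1 - c"
    by (intro prob_ge_of_count[OF P _ _ length_arrangements_pos, of b n E]) (simp_all add: E_sets E_prob)
  moreover have "c \<le> exp 1 * real n powr (- (\<epsilon>\<^sup>2 / 4))"
    unfolding c_def z_def u(1) by (rule miss_probability_le[OF \<epsilon> u(2,3) n])
  ultimately show ?thesis unfolding H_def space by linarith
qed

theorem theorem5p7:
  fixes t :: rtype
  shows "\<forall>\<epsilon>::real. 0 < \<epsilon> \<and> \<epsilon> < 1/2 \<longrightarrow>
    (\<exists>\<delta>::real. \<exists>C::real. 0 < \<delta> \<and> \<delta> < 1 \<and> 0 < C \<and>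
      (\<forall>(d::nat) (n::nat) (P :: (nat \<Rightarrow> nat \<Rightarrow> real) measure).
         real n > exp (real d / (u_of t - \<epsilon>)) \<longrightarrow>
         prob_space P \<longrightarrow> sets P = sets (tuple_space n d) \<longrightarrow>
         type_assms t d n P \<longrightarrow>
         measure P {\<omega> \<in> space P. in_conv_hull d (hull_points t d n \<omega>) (\<lambda>_. 0)}
           \<ge> 1 - C * real n powr (- \<delta>)))"
proof (intro allI impI)
  fix \<epsilon> :: real
  assume \<epsilon>: "0 < \<epsilon> \<and> \<epsilon> < 1/2"
  then have "\<epsilon>\<^sup>2 \<le> 1" by (intro power_le_one) auto
  with \<epsilon> show "\<exists>\<delta>::real. \<exists>C::real. 0 < \<delta> \<and> \<delta> < 1 \<and> 0 < C \<and>
      (\<forall>(d::nat) (n::nat) (P :: (nat \<Rightarrow> nat \<Rightarrow> real) measure).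
         real n > exp (real d / (u_of t - \<epsilon>)) \<longrightarrow>
         prob_space P \<longrightarrow> sets P = sets (tuple_space n d) \<longrightarrow>
         type_assms t d n P \<longrightarrow>
         measure P {\<omega> \<in> space P. in_conv_hull d (hull_points t d n \<omega>) (\<lambda>_. 0)}
           \<ge> 1 - C * real n powr (- \<delta>))"
    \<comment> \<open>Here \<open>\<epsilon>\<^sup>2 / 4\<close> is the decay exponent for the
      Chernoff parameter \<open>1 - \<epsilon> / 2\<close>, and \<open>exp 1\<close> is the price of
      the harmonic sum.\<close>
    by (intro exI[of _ "\<epsilon>\<^sup>2 / 4"] exI[of _ "exp 1"]) (auto intro: prob_zero_in_hull_ge)
qed

end
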